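(* Let $\delta\in(0,1)$, $B_W>0$, let $W$ be a finite subset of $\{w\in\mathbb R_+^m:\sum_{a\in A}w(s,a)\pi_\mu(a\mid s)\ge1-\gamma\ \forall s\in S\}$ and $V\subset\mathbb R^{|S|}$ a finite set. Assume the set $\mathcal I$ of inactive pairs is nonempty (so $\Delta_Q>0$) and: (i) there is $w^*\in W$ that solves $\min_{w}\max_{v\in\mathbb R^{|S|}}\ell(w,v)$ over $\{w\in\mathbb R_+^m:\sum_{a}w(s,a)\pi_\mu(a\mid s)\ge1-\gamma\ \forall s\}$, and hence also solves $\min_{w\in\mathbb R_+^m}\max_{v\in\mathbb R^{|S|}}\ell(w,v)$; moreover $\|w\|_\infty\le B_W$ for all $w\in W$; (ii) $v^*\in V\subseteq[-1/(1-\gamma),1/(1-\gamma)]^{|S|}$; (iii) there are a max-$\mu$-optimal policy $\pi^*$ and a constant $C^*>0$ with $\theta_{\pi^*,\mu}(s,a)\le C^*\mu(s,a)$ for all $(s,a)\in S\times A$. Let $C_{\max}>0$ be a constant such that $\theta_{\tilde\pi,\mu}(s)\le C_{\max}\mu(s)$ for every $\mu$-optimal policy $\tilde\pi$ and every $s\in S$. Let $w_{\mathcal D}$ be a solution of $\min_{w\in W}\max_{v\in V}\ell_{\mathcal D}(w,v)$ and $\pi_{\mathcal D}=\pi_{w_{\mathcal D}}$. Then, with probability at least $1-\delta$ over the dataset $\mathcal D$, $$J_\mu(\pi^* )-J_\mu(\pi_{\mathcal D})\le\frac{8\sqrt2\,B_WC_{\max}}{\Delta_Q(1-\gamma)^3}\cdot\frac{\sqrt{\log(|W||V|/\delta)}}{\sqrt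 n}.$$
   Context: MDP: $S,A$ finite, $m=|S||A|$, reward $r:S\times A\to[0,1]$, transition probabilities $P_{s,a}\in\Delta(S)$, $\gamma\in[0,1)$. A policy is $\pi:S\to\Delta(A)$, with discounted value functions $v_\pi,Q_\pi$. An optimal policy maximizes $v_\pi(s)$ simultaneously for all $s$; $v^*,Q^*$ are the optimal value functions. For $\rho\in\Delta(S)$, $\theta_{\pi,\rho}(s,a)=(1-\gamma)\sum_{t\ge0}\gamma^t\mathbb P_\pi(s_t=s,a_t=a;s_0\sim\rho)$, $\theta_{\pi,\rho}(s)=\sum_a\theta_{\pi,\rho}(s,a)$, $J_\rho(\pi)=\sum_{s,a}r(s,a)\theta_{\pi,\rho}(s,a)$. Data: $\mathcal D=\{(s_i,a_i,s_i',r_i)\}_{i=1}^n$ i.i.d., $(s_i,a_i)\sim\mu\in\Delta(S\times A)$, $s_i'\sim P_{s_i,a_i}$, $r_i=r(s_i,a_i)$. $\mu(s)=\sum_a\mu(s,a)$ (also viewed as a vector in $\mathbb R^{|S|}$, and $J_\mu,\theta_{\pi,\mu}$ use this state distribution). $\pi_\mu(a\mid s)=\mu(s,a)/\mu(s)$ if $\mu(s)>0$, and $0$ for all $a$ otherwise; it is known. $\mu_{\mathcal D}(s)=\frac1n|\{i:s_i=s\}|$. $u(s,a)=r(s,a)\mu(s,a)$; $u_{\mathcal D}^\top w=\frac1n\sum_ir_iw(s_i,a_i)$; $(Kw)(s)=\sum_aw(s,a)\mu(s,a)-\gamma\sum_{\bar s,a}P_{\bar s,a}(s)w(\bar s,a)\mu(\bar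 s,a)$; $(K_{\mathcal D}w)(s)=\frac1n\sum_iw(s_i,a_i)(\mathbf 1\{s_i=s\}-\gamma\mathbf 1\{s_i'=s\})$. $\ell(w,v)=-u^\top w+v^\top(Kw-(1-\gamma)\mu)$, $\ell_{\mathcal D}(w,v)=-u_{\mathcal D}^\top w+v^\top(K_{\mathcal D}w-(1-\gamma)\mu_{\mathcal D})$. $\pi_w(a\mid s)=\frac{w(s,a)\pi_\mu(a\mid s)}{\sum_{a'}w(s,a')\pi_\mu(a'\mid s)}$ if the denominator is positive, else $1/|A|$. $S_0=\{s:\mu(s)>0\}$, $S_\pi(s)=\{a:\pi(a\mid s)>0\}$, $\mathcal T(s)=\{a:Q^*(s,a)=v^*(s)\}$. A pair $(s,a)$ is inactive if $Q^*(s,a)\ne v^*(s)$; $\mathcal I$ is the set of inactive pairs and $\Delta_Q=\min_{(s,a)\in\mathcal I}(v^*(s)-Q^*(s,a))$. $\pi$ is a $\mu$-policy if for all $s\in S_0$, $\pi(a\mid s)>0$ implies $\mu(s,a)>0$; a $\mu$-optimal policy is an optimal $\mu$-policy; a max-$\mu$-optimal policy is a $\mu$-optimal policy $\pi$ with $|S_\pi(s)|=|S_{\pi_\mu}(s)\cap\mathcal T(s)|$ for all $s\in S_0$. *)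

theory Defs
  imports "HOL-Probability.Probability"
begin

section \<open>Markov decision processes\<close>

record ('s, 'a) mdp =
  rew   :: "'s \<Rightarrow> 'a \<Rightarrow> real"
  trans_prob :: "'s \<Rightarrow> 'a \<Rightarrow> 's pmf"
  disc  :: real

definition mdp :: "('s::finite, 'a::finite) mdp \<Rightarrow> bool" where
  "mdp M \<longleftrightarrow> (\<forall>s a. rew M s a \<in> {0..1}) \<and> 0 \<le> disc M \<and> disc M < 1"

type_synonym ('s, 'a) policy = "'s \<Rightarrow> 'a pmf"

text \<open>The law of \<open>(s\<^sub>t, a\<^sub>t)\<close> under the policy, when \<open>(s\<^sub>0, a\<^sub>0)\<close> has law \<open>d\<close>.\<close>

primrec sa_law ::
  "('s::finite, 'a::finite) mdp \<Rightarrow> ('s, 'a) policy \<Rightarrow> ('s \<times> 'a) pmf \<Rightarrow> nat \<Rightarrow> ('s \<times> 'a) pmf"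
where
  "sa_law M \<pi> d 0 = d"
| "sa_law M \<pi> d (Suc t) =
     do { (s, a) \<leftarrow> sa_law M \<pi> d t;
          s' \<leftarrow> trans_prob M s a;
          a' \<leftarrow> \<pi> s';
          return_pmf (s', a') }"

definition start_law :: "'s pmf \<Rightarrow> ('s, 'a) policy \<Rightarrow> ('s \<times> 'a) pmf" where
  "start_law \<rho> \<pi> = do { s \<leftarrow> \<rho>; a \<leftarrow> \<pi> s; return_pmf (s, a) }"

definition disc_return ::
  "('s::finite, 'a::finite) mdp \<Rightarrow> ('s, 'a) policy \<Rightarrow> ('s \<times> 'a) pmf \<Rightarrow> real" where
  "disc_return M \<pi> d =
     (\<Sum>t. disc M ^ t * measure_pmf.expectation (sa_law M \<pi> d t) (\<lambda>(s, a). rew M s a))"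

definition v_pol :: "('s::finite, 'a::finite) mdp \<Rightarrow> ('s, 'a) policy \<Rightarrow> 's \<Rightarrow> real" where
  "v_pol M \<pi> s = disc_return M \<pi> (start_law (return_pmf s) \<pi>)"

definition Q_pol :: "('s::finite, 'a::finite) mdp \<Rightarrow> ('s, 'a) policy \<Rightarrow> 's \<Rightarrow> 'a \<Rightarrow> real" where
  "Q_pol M \<pi> s a = disc_return M \<pi> (return_pmf (s, a))"

definition optimal :: "('s::finite, 'a::finite) mdp \<Rightarrow> ('s, 'a) policy \<Rightarrow> bool" where
  "optimal M \<pi> \<longleftrightarrow> (\<forall>\<pi>' s. v_pol M \<pi>' s \<le> v_pol M \<pi> s)"

definition v_opt :: "('s::finite, 'a::finite) mdp \<Rightarrow> 's \<Rightarrow> real" where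
  "v_opt M s = (SUP \<pi>. v_pol M \<pi> s)"

definition Q_opt :: "('s::finite, 'a::finite) mdp \<Rightarrow> 's \<Rightarrow> 'a \<Rightarrow> real" where
  "Q_opt M s a = (SUP \<pi>. Q_pol M \<pi> s a)"

definition occ ::
  "('s::finite, 'a::finite) mdp \<Rightarrow> ('s, 'a) policy \<Rightarrow> 's pmf \<Rightarrow> 's \<Rightarrow> 'a \<Rightarrow> real" where
  "occ M \<pi> \<rho> s a =
     (1 - disc M) * (\<Sum>t. disc M ^ t * pmf (sa_law M \<pi> (start_law \<rho> \<pi>) t) (s, a))"

definition occ_state ::
  "('s::finite, 'a::finite) mdp \<Rightarrow> ('s, 'a) policy \<Rightarrow> 's pmf \<Rightarrow> 's \<Rightarrow> real" where
  "occ_state M \<pi> \<rho> s = (\<Sum>a\<in>UNIV. occ M \<pi> \<rho> s a)"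

definition J :: "('s::finite, 'a::finite) mdp \<Rightarrow> 's pmf \<Rightarrow> ('s, 'a) policy \<Rightarrow> real" where
  "J M \<rho> \<pi> = (\<Sum>s\<in>UNIV. \<Sum>a\<in>UNIV. rew M s a * occ M \<pi> \<rho> s a)"

definition inactive :: "('s::finite, 'a::finite) mdp \<Rightarrow> ('s \<times> 'a) set" where
  "inactive M = {(s, a). Q_opt M s a \<noteq> v_opt M s}"

definition gap_Q :: "('s::finite, 'a::finite) mdp \<Rightarrow> real" where
  "gap_Q M = (MIN (s, a)\<in>inactive M. v_opt M s - Q_opt M s a)"

definition tight :: "('s::finite, 'a::finite) mdp \<Rightarrow> 's \<Rightarrow> 'a set" where
  "tight M s = {a. Q_opt M s a = v_opt M s}"


section \<open>Offline data\<close>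

text \<open>The state marginal \<open>\<mu>(s) = (\<Sum>a. \<mu>(s, a))\<close>.\<close>

definition state_marg :: "('s \<times> 'a) pmf \<Rightarrow> 's pmf" where
  "state_marg \<mu> = map_pmf fst \<mu>"

text \<open>Not a \<open>pmf\<close>-valued map: the row of a state outside the support of the marginal is zero.\<close>

definition behav :: "('s::finite \<times> 'a::finite) pmf \<Rightarrow> 's \<Rightarrow> 'a \<Rightarrow> real" where
  "behav \<mu> s a =
     (if pmf (state_marg \<mu>) s > 0 then pmf \<mu> (s, a) / pmf (state_marg \<mu>) s else 0)"

definition pos_supp :: "('a \<Rightarrow> real) \<Rightarrow> 'a set" where
  "pos_supp p = {a. p a > 0}"

definition data_states :: "('s \<times> 'a) pmf \<Rightarrow> 's set" where
  "data_states \<mu> = {s. pmf (state_marg \<mu>) s > 0}"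

definition mu_policy :: "('s \<times> 'a) pmf \<Rightarrow> ('s, 'a) policy \<Rightarrow> bool" where
  "mu_policy \<mu> \<pi> \<longleftrightarrow> (\<forall>s\<in>data_states \<mu>. \<forall>a. pmf (\<pi> s) a > 0 \<longrightarrow> pmf \<mu> (s, a) > 0)"

definition mu_optimal ::
  "('s::finite, 'a::finite) mdp \<Rightarrow> ('s \<times> 'a) pmf \<Rightarrow> ('s, 'a) policy \<Rightarrow> bool" where
  "mu_optimal M \<mu> \<pi> \<longleftrightarrow> optimal M \<pi> \<and> mu_policy \<mu> \<pi>"

definition max_mu_optimal ::
  "('s::finite, 'a::finite) mdp \<Rightarrow> ('s \<times> 'a) pmf \<Rightarrow> ('s, 'a) policy \<Rightarrow> bool" where
  "max_mu_optimal M \<mu> \<pi> \<longleftrightarrow> mu_optimal M \<mu> \<pi> \<and>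
     (\<forall>s\<in>data_states \<mu>.
        card (pos_supp (pmf (\<pi> s))) = card (pos_supp (behav \<mu> s) \<inter> tight M s))"

text \<open>A sample is \<open>(s, a, s', r)\<close> and a dataset is a list of samples, so its size is its length.\<close>

type_synonym ('s, 'a) sample = "'s \<times> 'a \<times> 's \<times> real"

definition sample_law ::
  "('s, 'a) mdp \<Rightarrow> ('s \<times> 'a) pmf \<Rightarrow> ('s, 'a) sample pmf" where
  "sample_law M \<mu> =
     do { (s, a) \<leftarrow> \<mu>; s' \<leftarrow> trans_prob M s a; return_pmf (s, a, s', rew M s a) }"

definition data_law ::
  "('s, 'a) mdp \<Rightarrow> ('s \<times> 'a) pmf \<Rightarrow> nat \<Rightarrow> ('s, 'a) sample list pmf" where
  "data_law M \<mu> n = replicate_pmf n (sample_law M \<mu>)"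


section \<open>The Lagrangian and its empirical version\<close>

definition u_pop ::
  "('s::finite, 'a::finite) mdp \<Rightarrow> ('s \<times> 'a) pmf \<Rightarrow> 's \<Rightarrow> 'a \<Rightarrow> real" where
  "u_pop M \<mu> s a = rew M s a * pmf \<mu> (s, a)"

definition K_pop ::
  "('s::finite, 'a::finite) mdp \<Rightarrow> ('s \<times> 'a) pmf \<Rightarrow> ('s \<Rightarrow> 'a \<Rightarrow> real) \<Rightarrow> 's \<Rightarrow> real" where
  "K_pop M \<mu> w s =
     (\<Sum>a\<in>UNIV. w s a * pmf \<mu> (s, a))
     - disc M * (\<Sum>z\<in>UNIV. \<Sum>a\<in>UNIV. pmf (trans_prob M z a) s * w z a * pmf \<mu> (z, a))"

definition loss ::
  "('s::finite, 'a::finite) mdp \<Rightarrow> ('s \<times> 'a) pmf \<Rightarrow> ('s \<Rightarrow> 'a \<Rightarrow> real) \<Rightarrow> ('s \<Rightarrow> real) \<Rightarrow> real"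
where
  "loss M \<mu> w v =
     - (\<Sum>s\<in>UNIV. \<Sum>a\<in>UNIV. u_pop M \<mu> s a * w s a)
     + (\<Sum>s\<in>UNIV. v s * (K_pop M \<mu> w s - (1 - disc M) * pmf (state_marg \<mu>) s))"

definition mu_emp :: "('s, 'a) sample list \<Rightarrow> 's \<Rightarrow> real" where
  "mu_emp D s = real (card {i. i < length D \<and> fst (D ! i) = s}) / real (length D)"

definition u_emp :: "('s, 'a) sample list \<Rightarrow> ('s \<Rightarrow> 'a \<Rightarrow> real) \<Rightarrow> real" where
  "u_emp D w = (\<Sum>(s, a, s', x)\<leftarrow>D. x * w s a) / real (length D)"

definition K_emp ::
  "('s, 'a) mdp \<Rightarrow> ('s, 'a) sample list \<Rightarrow> ('s \<Rightarrow> 'a \<Rightarrow> real) \<Rightarrow> 's \<Rightarrow> real" where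
  "K_emp M D w z =
     (\<Sum>(s, a, s', x)\<leftarrow>D. w s a * (of_bool (s = z) - disc M * of_bool (s' = z)))
     / real (length D)"

definition loss_emp ::
  "('s::finite, 'a::finite) mdp \<Rightarrow> ('s, 'a) sample list \<Rightarrow> ('s \<Rightarrow> 'a \<Rightarrow> real) \<Rightarrow> ('s \<Rightarrow> real) \<Rightarrow> real"
where
  "loss_emp M D w v =
     - u_emp D w + (\<Sum>s\<in>UNIV. v s * (K_emp M D w s - (1 - disc M) * mu_emp D s))"

text \<open>
  \<open>w\<close> solves \<open>min\<^sub>w max\<^sub>v L(w, v)\<close> over \<open>W\<close> and \<open>V\<close>.  The inner maximum is taken in the
  extended reals because it is \<open>\<infinity>\<close> for infeasible \<open>w\<close> when \<open>V\<close> is the whole space.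
\<close>

definition minmax_solution :: "('w \<Rightarrow> 'v \<Rightarrow> real) \<Rightarrow> 'w set \<Rightarrow> 'v set \<Rightarrow> 'w \<Rightarrow> bool" where
  "minmax_solution L W V w \<longleftrightarrow>
     w \<in> W \<and> (\<forall>w'\<in>W. (SUP v\<in>V. ereal (L w v)) \<le> (SUP v\<in>V. ereal (L w' v)))"

definition weights ::
  "('s::finite, 'a::finite) mdp \<Rightarrow> ('s \<times> 'a) pmf \<Rightarrow> ('s \<Rightarrow> 'a \<Rightarrow> real) set" where
  "weights M \<mu> = {w. (\<forall>s a. 0 \<le> w s a) \<and> (\<forall>s. (\<Sum>a\<in>UNIV. w s a * behav \<mu> s a) \<ge> 1 - disc M)}"

definition sup_norm :: "('s::finite \<Rightarrow> 'a::finite \<Rightarrow> real) \<Rightarrow> real" where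
  "sup_norm w = (MAX (s, a)\<in>UNIV. \<bar>w s a\<bar>)"

text \<open>
  For nonnegative \<open>w\<close> the function below is a probability mass function, so \<open>embed_pmf\<close>
  returns the distribution with these masses.
\<close>

definition weight_policy ::
  "('s::finite \<times> 'a::finite) pmf \<Rightarrow> ('s \<Rightarrow> 'a \<Rightarrow> real) \<Rightarrow> ('s, 'a) policy" where
  "weight_policy \<mu> w s = embed_pmf (\<lambda>a.
     let Z = (\<Sum>b\<in>UNIV. w s b * behav \<mu> s b)
     in if Z > 0 then w s a * behav \<mu> s a / Z else 1 / real CARD('a))"

end

theory Submission
  imports Defs
begin

text \<open>
  Since every \<open>w \<in> W\<close> has \<open>(\<Sum>a. w(s,a) \<pi>\<^sub>\<mu>(a|s)) \<ge> 1 - \<gamma> > 0\<close>, all states carry data.  Let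
  \<open>A(w) = (\<Sum>s,a. w(s,a) \<mu>(s,a) (v\<^sup>*(s) - Q\<^sup>*(s,a)))\<close>, so that \<open>\<ell>(w, v\<^sup>*) = A(w) - J(\<pi>\<^sup>*)\<close>, whereas
  \<open>\<ell>(w\<^sup>*, v) \<le> - J(\<pi>\<^sup>*)\<close> for all \<open>v\<close> because the occupancy density of \<open>\<pi>\<^sup>*\<close> is a competitor.
  Optimality of \<open>w\<^sub>D\<close> yields some \<open>v \<in> V\<close> with \<open>\<ell>\<^sub>D(w\<^sub>D, v\<^sup>*) \<le> \<ell>\<^sub>D(w\<^sup>*, v)\<close>, so Hoeffding's inequality
  for the differences \<open>\<ell>\<^sub>D(w\<^sup>*, v) - \<ell>\<^sub>D(w, v\<^sup>*)\<close> and a union bound over exactly \<open>|W||V|\<close> events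
  bound \<open>A(w\<^sub>D)\<close>, and with it the mass that \<open>\<pi>\<^sub>D\<close> puts on inactive pairs.  Conditioning \<open>\<pi>\<^sub>D\<close> on the
  active actions gives a \<open>\<mu>\<close>-optimal policy, to which \<open>C\<^sub>m\<^sub>a\<^sub>x\<close> applies; the performance difference
  between it and \<open>\<pi>\<^sub>D\<close> is controlled by that inactive mass.
\<close>

section \<open>Bellman equations and occupancy measures\<close>

text \<open>The argument \<open>f\<close> is left free: below it is instantiated by
  \<open>v_pol\<close>, by \<open>v_opt\<close> and by the dual variable of the Lagrangian.\<close>

definition bellman_Q ::
  "('s::finite, 'a::finite) mdp \<Rightarrow> ('s \<Rightarrow> real) \<Rightarrow> 's \<Rightarrow> 'a \<Rightarrow> real" where
  "bellman_Q M f s a = rew M s a + disc M * (\<Sum>s'\<in>UNIV. pmf (trans_prob M s a) s' * f s')"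

text \<open>Kernel of the Markov chain on state-action pairs. Phrased through
  \<open>start_law\<close>, one step from a pair is a mixture of the start laws that define
  \<open>v_pol\<close>, which turns \<open>disc_return_unfold\<close> into a Bellman
  equation.\<close>

definition sa_step ::
  "('s::finite, 'a::finite) mdp \<Rightarrow> ('s, 'a) policy \<Rightarrow> 's \<times> 'a \<Rightarrow> ('s \<times> 'a) pmf" where
  "sa_step M \<pi> = (\<lambda>(s, a). do { s' \<leftarrow> trans_prob M s a; start_law (return_pmf s') \<pi> })"

section \<open>Finite mass functions and the laws of the state-action chain\<close>

lemma expectation_finite:
  fixes p :: "'x::finite pmf" and h :: "'x \<Rightarrow> real"
  shows "measure_pmf.expectation p h = (\<Sum>x\<in>UNIV. pmf p x * h x)"
  by (subst integral_measure_pmf[of UNIV]) auto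

lemma pmf_bind_finite:
  fixes p :: "'x::finite pmf"
  shows "pmf (bind_pmf p f) y = (\<Sum>x\<in>UNIV. pmf p x * pmf (f x) y)"
  by (simp add: pmf_bind expectation_finite)

lemma expectation_bind_finite:
  fixes p :: "'x::finite pmf" and h :: "'y::finite \<Rightarrow> real"
  shows "measure_pmf.expectation (bind_pmf p f) h
    = (\<Sum>x\<in>UNIV. pmf p x * measure_pmf.expectation (f x) h)"
  unfolding expectation_finite pmf_bind_finite sum_distrib_right sum_distrib_left
  by (subst sum.swap) (simp add: mult.assoc)

lemma sum_prod_finite:
  fixes f :: "'s::finite \<times> 'a::finite \<Rightarrow> real"
  shows "(\<Sum>z\<in>UNIV. f z) = (\<Sum>s\<in>UNIV. \<Sum>a\<in>UNIV. f (s, a))"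
  by (simp add: sum.cartesian_product UNIV_Times_UNIV)

lemma sum_pmf_UNIV:
  fixes p :: "'x::finite pmf"
  shows "(\<Sum>x\<in>UNIV. pmf p x) = 1"
  by (rule sum_pmf_eq_1) auto

lemma sa_law_Suc_step: "sa_law M \<pi> d (Suc t) = sa_law M \<pi> d t \<bind> sa_step M \<pi>"
  by (simp add: sa_step_def start_law_def bind_return_pmf case_prod_unfold)

text \<open>The recursion for \<open>sa_law\<close> appends the last step; the Bellman equation
  needs the first step peeled off instead.\<close>

lemma sa_law_Suc_shift: "sa_law M \<pi> d (Suc t) = sa_law M \<pi> (d \<bind> sa_step M \<pi>) t"
  by (induction t) (simp_all only: sa_law_Suc_step sa_law.simps(1))

lemma sa_law_bind: "sa_law M \<pi> (bind_pmf p f) t = bind_pmf p (\<lambda>x. sa_law M \<pi> (f x) t)"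
  by (induction t) (simp_all add: sa_law_Suc_step bind_assoc_pmf del: sa_law.simps(2))

lemma start_law_bind: "start_law \<rho> \<pi> = \<rho> \<bind> (\<lambda>s. start_law (return_pmf s) \<pi>)"
  by (simp add: start_law_def bind_return_pmf)

lemma pmf_start_law: "pmf (start_law \<rho> \<pi>) (s, a) = pmf \<rho> (s::'s::finite) * pmf (\<pi> s) (a::'a::finite)"
proof -
  have "pmf (start_law \<rho> \<pi>) (s, a) =
      (\<Sum>x\<in>UNIV. \<Sum>y\<in>UNIV. of_bool (x = s \<and> y = a) * (pmf \<rho> x * pmf (\<pi> x) y))"
    unfolding start_law_def pmf_bind_finite sum_distrib_left
    by (intro sum.cong) (auto simp: pmf_return)
  also have "\<dots> = (\<Sum>x\<in>UNIV. if x = s then pmf \<rho> s * pmf (\<pi> s) a else 0)"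
  proof (intro sum.cong refl)
    fix x
    show "(\<Sum>y\<in>UNIV. of_bool (x = s \<and> y = a) * (pmf \<rho> x * pmf (\<pi> x) y))
      = (if x = s then pmf \<rho> s * pmf (\<pi> s) a else 0)"
      by (cases "x = s") (simp_all add: of_bool_def if_distrib[of "\<lambda>c. c * _"] cong: if_cong)
  qed
  finally show ?thesis by simp
qed

lemma pmf_sa_step:
  "pmf (sa_step M \<pi> (z, b)) (s, a) = pmf (trans_prob M z b) (s::'s::finite) * pmf (\<pi> s) (a::'a::finite)"
  unfolding sa_step_def by (simp add: start_law_bind[symmetric] pmf_start_law)

lemma pmf_sa_law_Suc:
  "pmf (sa_law M \<pi> d (Suc t)) (s, a) =
     pmf (\<pi> s) a * (\<Sum>z\<in>UNIV. \<Sum>b\<in>UNIV. pmf (sa_law M \<pi> d t) (z, b) * pmf (trans_prob M z b) s)"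
  by (simp add: sa_law_Suc_step pmf_bind_finite sum_prod_finite pmf_sa_step sum_distrib_left
      mult_ac del: sa_law.simps(2))

section \<open>Discounted returns and the Bellman equations of a single policy\<close>

context
  fixes M :: "('s::finite, 'a::finite) mdp"
  assumes mdp: "mdp M"
begin

lemma disc_bounds: "0 \<le> disc M" "disc M < 1"
  and rew_bounds: "0 \<le> rew M s a" "rew M s a \<le> 1"
  using mdp by (auto simp: mdp_def)

lemma summable_disc:
  assumes "\<And>t. \<bar>x t\<bar> \<le> (1::real)"
  shows "summable (\<lambda>t. disc M ^ t * x t)"
proof (rule summable_comparison_test')
  show "summable (\<lambda>t. disc M ^ t)"
    using disc_bounds by (simp add: summable_geometric)
  show "norm (disc M ^ t * x t) \<le> disc M ^ t" for t
    using disc_bounds assms[of t] by (simp add: abs_mult mult_left_le)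
qed

lemma expectation_rew_bounds:
  fixes d :: "('s \<times> 'a) pmf"
  shows "measure_pmf.expectation d (\<lambda>(s, a). rew M s a) \<in> {0..1}"
proof -
  have "(\<Sum>z\<in>UNIV. pmf d z * (case z of (s, a) \<Rightarrow> rew M s a)) \<le> (\<Sum>z\<in>UNIV. pmf d z)"
    by (intro sum_mono) (auto simp: mult_left_le rew_bounds)
  then show ?thesis
    by (auto simp: expectation_finite sum_pmf_UNIV rew_bounds intro!: sum_nonneg split: prod.splits)
qed

lemma summable_return:
  "summable (\<lambda>t. disc M ^ t * measure_pmf.expectation (sa_law M \<pi> d t) (\<lambda>(s, a). rew M s a))"
  using expectation_rew_bounds by (intro summable_disc) (auto simp: abs_le_iff intro: order.trans)

lemma summable_pmf: "summable (\<lambda>t. disc M ^ t * pmf (sa_law M \<pi> d t) z)"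
  by (intro summable_disc) (simp add: pmf_le_1)

lemma disc_return_bounds: "0 \<le> disc_return M \<pi> d" "disc_return M \<pi> d \<le> 1 / (1 - disc M)"
proof -
  show "0 \<le> disc_return M \<pi> d"
    unfolding disc_return_def using disc_bounds expectation_rew_bounds
    by (intro suminf_nonneg summable_return mult_nonneg_nonneg) auto
  have "disc_return M \<pi> d \<le> (\<Sum>t. disc M ^ t)"
    unfolding disc_return_def using disc_bounds expectation_rew_bounds
    by (intro suminf_le summable_return) (auto simp: mult_left_le summable_geometric)
  then show "disc_return M \<pi> d \<le> 1 / (1 - disc M)"
    using disc_bounds by (simp add: suminf_geometric)
qed

lemma v_pol_bounds: "0 \<le> v_pol M \<pi> s" "v_pol M \<pi> s \<le> 1 / (1 - disc M)"
  and Q_pol_bounds: "0 \<le> Q_pol M \<pi> s a" "Q_pol M \<pi> s a \<le> 1 / (1 - disc M)"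
  by (simp_all add: v_pol_def Q_pol_def disc_return_bounds)

text \<open>The laws of the chain are linear in the start law by \<open>sa_law_bind\<close>, and a
  finite sum commutes with the convergent discounted series.\<close>

lemma disc_return_bind:
  fixes p :: "'x::finite pmf"
  shows "disc_return M \<pi> (bind_pmf p f) = (\<Sum>x\<in>UNIV. pmf p x * disc_return M \<pi> (f x))"
  unfolding disc_return_def sa_law_bind expectation_bind_finite sum_distrib_left
  by (subst suminf_sum)
    (auto simp: mult.left_commute summable_return summable_mult suminf_mult intro!: sum.cong)

lemma disc_return_unfold:
  "disc_return M \<pi> d = measure_pmf.expectation d (\<lambda>(s, a). rew M s a)
     + disc M * disc_return M \<pi> (d \<bind> sa_step M \<pi>)"
proof -
  let ?e = "\<lambda>d t. measure_pmf.expectation (sa_law M \<pi> d t) (\<lambda>(s, a). rew M s a)"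
  have "disc_return M \<pi> d = disc M ^ 0 * ?e d 0 + (\<Sum>t. disc M ^ Suc t * ?e d (Suc t))"
    unfolding disc_return_def by (subst suminf_split_head[OF summable_return]) simp
  also have "(\<Sum>t. disc M ^ Suc t * ?e d (Suc t)) = disc M * disc_return M \<pi> (d \<bind> sa_step M \<pi>)"
    unfolding disc_return_def sa_law_Suc_shift
    by (subst suminf_mult[OF summable_return, symmetric]) (simp add: mult_ac)
  finally show ?thesis by simp
qed

lemma Q_pol_eq: "Q_pol M \<pi> s a = bellman_Q M (v_pol M \<pi>) s a"
  unfolding Q_pol_def
  by (subst disc_return_unfold)
    (simp add: bind_return_pmf sa_step_def disc_return_bind bellman_Q_def v_pol_def)

lemma v_pol_eq: "v_pol M \<pi> s = (\<Sum>a\<in>UNIV. pmf (\<pi> s) a * Q_pol M \<pi> s a)"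
  unfolding v_pol_def start_law_def
  by (simp add: bind_return_pmf disc_return_bind Q_pol_def)

section \<open>Occupancy measures and the flow equation\<close>

lemma occ_eq_flow:
  "occ M \<pi> \<rho> s a = pmf (\<pi> s) a * ((1 - disc M) * pmf \<rho> s
     + disc M * (\<Sum>z\<in>UNIV. \<Sum>b\<in>UNIV. occ M \<pi> \<rho> z b * pmf (trans_prob M z b) s))"
proof -
  let ?p = "\<lambda>t. pmf (sa_law M \<pi> (start_law \<rho> \<pi>) t)"
  let ?S = "\<lambda>z b. \<Sum>t. disc M ^ t * ?p t (z, b)"
  have "(\<Sum>t. disc M ^ t * ?p t (s, a)) = ?p 0 (s, a) + (\<Sum>t. disc M ^ Suc t * ?p (Suc t) (s, a))"
    by (subst suminf_split_head[OF summable_pmf]) simp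
  \<comment> \<open>At every later time the action is drawn from \<open>\<pi> s\<close>, whichever
    pair came before, so \<open>pmf (\<pi> s) a\<close> factors out and the inflow into
    \<open>s\<close> remains.\<close>
  also have "(\<Sum>t. disc M ^ Suc t * ?p (Suc t) (s, a)) = (\<Sum>t. \<Sum>z\<in>UNIV. \<Sum>b\<in>UNIV.
      (disc M * pmf (\<pi> s) a * pmf (trans_prob M z b) s) * (disc M ^ t * ?p t (z, b)))"
    by (simp add: pmf_sa_law_Suc sum_distrib_left mult_ac del: sa_law.simps(2))
  also have "\<dots> = (\<Sum>z\<in>UNIV. \<Sum>b\<in>UNIV. (disc M * pmf (\<pi> s) a * pmf (trans_prob M z b) s) * ?S z b)"
    by (simp add: suminf_sum suminf_mult summable_sum summable_mult summable_pmf)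
  finally have *: "?S s a = pmf \<rho> s * pmf (\<pi> s) a + (\<Sum>z\<in>UNIV. \<Sum>b\<in>UNIV.
      (disc M * pmf (\<pi> s) a * pmf (trans_prob M z b) s) * ?S z b)"
    by (simp add: pmf_start_law)
  show ?thesis
    unfolding occ_def by (subst *) (simp add: distrib_left sum_distrib_left mult_ac)
qed

lemma occ_state_flow:
  "occ_state M \<pi> \<rho> s = (1 - disc M) * pmf \<rho> s
     + disc M * (\<Sum>z\<in>UNIV. \<Sum>b\<in>UNIV. occ M \<pi> \<rho> z b * pmf (trans_prob M z b) s)"
proof -
  have "occ_state M \<pi> \<rho> s = (\<Sum>a\<in>UNIV. pmf (\<pi> s) a) * ((1 - disc M) * pmf \<rho> s
     + disc M * (\<Sum>z\<in>UNIV. \<Sum>b\<in>UNIV. occ M \<pi> \<rho> z b * pmf (trans_prob M z b) s))"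
    unfolding occ_state_def sum_distrib_right by (intro sum.cong refl occ_eq_flow)
  then show ?thesis by (simp add: sum_pmf_UNIV)
qed

lemma occ_eq_occ_state: "occ M \<pi> \<rho> s a = pmf (\<pi> s) a * occ_state M \<pi> \<rho> s"
  by (subst occ_eq_flow) (simp add: occ_state_flow)

lemma occ_nonneg: "0 \<le> occ M \<pi> \<rho> s a"
  unfolding occ_def using disc_bounds
  by (intro mult_nonneg_nonneg suminf_nonneg summable_pmf) auto

lemma occ_state_ge: "(1 - disc M) * pmf \<rho> s \<le> occ_state M \<pi> \<rho> s"
  using disc_bounds
  by (simp add: occ_state_flow) (intro mult_nonneg_nonneg sum_nonneg occ_nonneg; simp)

lemma occ_state_nonneg: "0 \<le> occ_state M \<pi> \<rho> s"
  unfolding occ_state_def by (intro sum_nonneg occ_nonneg)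

lemma J_eq_v_pol: "J M \<rho> \<pi> = (1 - disc M) * (\<Sum>s\<in>UNIV. pmf \<rho> s * v_pol M \<pi> s)"
proof -
  let ?p = "\<lambda>t. pmf (sa_law M \<pi> (start_law \<rho> \<pi>) t)"
  have "J M \<rho> \<pi> = (1 - disc M) * (\<Sum>s\<in>UNIV. \<Sum>a\<in>UNIV. \<Sum>t. disc M ^ t * (?p t (s, a) * rew M s a))"
    unfolding J_def occ_def
    using suminf_mult[OF summable_pmf]
    by (simp add: sum_distrib_left mult_ac)
  also have "(\<Sum>s\<in>UNIV. \<Sum>a\<in>UNIV. \<Sum>t. disc M ^ t * (?p t (s, a) * rew M s a))
      = disc_return M \<pi> (start_law \<rho> \<pi>)"
    unfolding disc_return_def expectation_finite sum_prod_finite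
    using summable_mult2[OF summable_pmf]
    by (simp add: suminf_sum summable_sum sum_distrib_left mult.assoc)
  also have "\<dots> = (\<Sum>s\<in>UNIV. pmf \<rho> s * v_pol M \<pi> s)"
    by (subst start_law_bind) (simp add: disc_return_bind v_pol_def)
  finally show ?thesis .
qed

text \<open>The flow equation paired with a test function. With \<open>f\<close> the value of
  another policy this is the performance difference identity; with \<open>f = v_opt M\<close> it
  yields the optimality criteria; with \<open>f\<close> arbitrary it evaluates the Lagrangian at an
  occupancy density.\<close>

lemma occ_flow_dual:
  fixes f :: "'s \<Rightarrow> real"
  shows "(\<Sum>s\<in>UNIV. \<Sum>a\<in>UNIV. occ M \<pi> \<rho> s a * (bellman_Q M f s a - f s))
     = J M \<rho> \<pi> - (1 - disc M) * (\<Sum>s\<in>UNIV. pmf \<rho> s * f s)"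
proof -
  let ?N = "\<Sum>z\<in>UNIV. \<Sum>b\<in>UNIV. \<Sum>s\<in>UNIV. occ M \<pi> \<rho> z b * (pmf (trans_prob M z b) s * f s)"
  have "(\<Sum>s\<in>UNIV. \<Sum>a\<in>UNIV. occ M \<pi> \<rho> s a * f s) = (\<Sum>s\<in>UNIV. occ_state M \<pi> \<rho> s * f s)"
    by (simp add: occ_state_def sum_distrib_right)
  also have "\<dots> = (1 - disc M) * (\<Sum>s\<in>UNIV. pmf \<rho> s * f s) + disc M * (\<Sum>s\<in>UNIV. \<Sum>z\<in>UNIV. \<Sum>b\<in>UNIV.
      occ M \<pi> \<rho> z b * (pmf (trans_prob M z b) s * f s))"
    unfolding occ_state_flow
    by (simp add: distrib_right sum.distrib sum_distrib_left sum_distrib_right mult.assoc)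
  also have "(\<Sum>s\<in>UNIV. \<Sum>z\<in>UNIV. \<Sum>b\<in>UNIV. occ M \<pi> \<rho> z b * (pmf (trans_prob M z b) s * f s))
     = (\<Sum>z\<in>UNIV. \<Sum>s\<in>UNIV. \<Sum>b\<in>UNIV. occ M \<pi> \<rho> z b * (pmf (trans_prob M z b) s * f s))"
    by (rule sum.swap)
  also have "\<dots> = ?N"
    by (intro sum.cong refl) (rule sum.swap)
  finally have *: "(\<Sum>s\<in>UNIV. \<Sum>a\<in>UNIV. occ M \<pi> \<rho> s a * f s)
      = (1 - disc M) * (\<Sum>s\<in>UNIV. pmf \<rho> s * f s) + disc M * ?N" .
  have "(\<Sum>s\<in>UNIV. \<Sum>a\<in>UNIV. occ M \<pi> \<rho> s a * bellman_Q M f s a) = J M \<rho> \<pi> + disc M * ?N"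
    by (simp add: J_def bellman_Q_def distrib_left sum.distrib sum_distrib_left mult_ac)
  with * show ?thesis
    by (simp add: right_diff_distrib sum_subtractf)
qed

lemma J_return: "J M (return_pmf s) \<pi> = (1 - disc M) * v_pol M \<pi> s"
  by (simp add: J_eq_v_pol of_bool_def if_distrib[of "\<lambda>c. c * _"] pmf_return indicator_def cong: if_cong)

section \<open>Optimal policies and active actions\<close>

lemma v_opt_eq: "optimal M \<pi> \<Longrightarrow> v_opt M = v_pol M \<pi>"
  unfolding v_opt_def optimal_def
  by (intro ext cSup_eq_maximum) auto

text \<open>An optimal policy maximizes the value at all successor states at once, so by
  monotonicity of the backup it attains the supremum defining \<open>Q_opt\<close>.\<close>

lemma Q_opt_eq:
  assumes "optimal M \<pi>"
  shows "Q_opt M s a = bellman_Q M (v_opt M) s a"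
proof -
  have "Q_pol M \<pi>' s a \<le> Q_pol M \<pi> s a" for \<pi>'
    using assms disc_bounds unfolding Q_pol_eq bellman_Q_def optimal_def
    by (intro add_left_mono mult_left_mono sum_mono) auto
  then have "Q_opt M s a = Q_pol M \<pi> s a"
    unfolding Q_opt_def by (intro cSup_eq_maximum) auto
  then show ?thesis by (simp add: Q_pol_eq v_opt_eq[OF assms])
qed

text \<open>Policy improvement: were the inequality false, an optimal policy redirected to
  \<open>a\<close> at the single state \<open>s\<close> would do strictly better from
  \<open>s\<close>. In \<open>occ_flow_dual\<close> with \<open>f = v_opt M\<close> all other states
  contribute zero, because there the average advantage of an optimal policy vanishes.\<close>

lemma Q_opt_le:
  assumes opt: "optimal M \<pi>"
  shows "Q_opt M s a \<le> v_opt M s"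
proof (rule ccontr)
  assume gt: "\<not> Q_opt M s a \<le> v_opt M s"
  define \<pi>' where "\<pi>' = \<pi>(s := return_pmf a)"
  let ?o = "occ_state M \<pi>' (return_pmf s)"
  have v: "(\<Sum>b\<in>UNIV. pmf (\<pi> x) b * (Q_opt M x b - v_opt M x)) = 0" for x
    using v_pol_eq[of \<pi> x] Q_opt_eq[OF opt] v_opt_eq[OF opt]
    by (simp add: right_diff_distrib sum_subtractf sum_distrib_right[symmetric] sum_pmf_UNIV Q_pol_eq)
  have s: "(\<Sum>b\<in>UNIV. pmf (\<pi>' s) b * (Q_opt M s b - v_opt M s)) = Q_opt M s a - v_opt M s"
    by (simp add: \<pi>'_def pmf_return indicator_def if_distrib[of "\<lambda>c. c * _"] of_bool_def cong: if_cong)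
  have "(1 - disc M) * (v_pol M \<pi>' s - v_opt M s)
     = (\<Sum>x\<in>UNIV. \<Sum>b\<in>UNIV. occ M \<pi>' (return_pmf s) x b * (Q_opt M x b - v_opt M x))"
    using occ_flow_dual[of \<pi>' "return_pmf s" "v_opt M"] unfolding J_return Q_opt_eq[OF opt]
    by (simp add: pmf_return indicator_def if_distrib[of "\<lambda>c. c * _"] of_bool_def right_diff_distrib cong: if_cong)
  also have "\<dots> = (\<Sum>x\<in>UNIV. ?o x * (\<Sum>b\<in>UNIV. pmf (\<pi>' x) b * (Q_opt M x b - v_opt M x)))"
    by (simp add: occ_eq_occ_state sum_distrib_left mult_ac)
  also have "\<dots> = (\<Sum>x\<in>UNIV. if x = s then ?o s * (Q_opt M s a - v_opt M s) else 0)"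
    by (intro sum.cong) (use s v in \<open>auto simp: \<pi>'_def\<close>)
  finally have "(1 - disc M) * (v_pol M \<pi>' s - v_opt M s) = ?o s * (Q_opt M s a - v_opt M s)"
    by simp
  \<comment> \<open>The chain starts in \<open>s\<close>, so time 0 alone gives occupancy
    \<open>1 - disc M\<close>.\<close>
  moreover have "?o s > 0"
    using occ_state_ge[of "return_pmf s" s \<pi>'] disc_bounds by simp
  ultimately have "v_pol M \<pi>' s > v_opt M s"
    using gt disc_bounds by (smt (verit) mult_pos_pos mult_nonneg_nonpos)
  then show False
    using opt v_opt_eq[OF opt] by (auto simp: optimal_def not_less[symmetric])
qed

text \<open>Every summand of \<open>occ_flow_dual\<close> with \<open>f = v_opt M\<close> vanishes:
  either the action is never played or its advantage is zero. Point masses as start laws then give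
  equality of values in each state.\<close>

lemma optimal_if_tight:
  assumes opt: "optimal M \<pi>" and supp: "\<And>s. set_pmf (\<pi>' s) \<subseteq> tight M s"
  shows "optimal M \<pi>'"
proof -
  have "v_pol M \<pi>' s = v_opt M s" for s
  proof -
    have "(\<Sum>x\<in>UNIV. \<Sum>b\<in>UNIV. occ M \<pi>' (return_pmf s) x b * (bellman_Q M (v_opt M) x b - v_opt M x)) = 0"
    proof (intro sum.neutral ballI)
      fix x b
      have "pmf (\<pi>' x) b = 0 \<or> Q_opt M x b = v_opt M x"
        using supp[of x] by (auto simp: tight_def set_pmf_iff)
      then show "occ M \<pi>' (return_pmf s) x b * (bellman_Q M (v_opt M) x b - v_opt M x) = 0"
        by (auto simp: occ_eq_occ_state Q_opt_eq[OF opt])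
    qed
    then have "(1 - disc M) * (v_pol M \<pi>' s - v_opt M s) = 0"
      unfolding occ_flow_dual J_return
      by (simp add: pmf_return indicator_def if_distrib[of "\<lambda>c. c * _"] of_bool_def right_diff_distrib cong: if_cong)
    then show ?thesis using disc_bounds by simp
  qed
  then show ?thesis
    using opt v_opt_eq[OF opt] by (simp add: optimal_def)
qed

text \<open>The gaps \<open>v_opt M s - Q_opt M s b\<close> are nonnegative and average to zero
  under \<open>\<pi> s\<close>, so each gap of positive weight is zero.\<close>

lemma tight_if_optimal:
  assumes opt: "optimal M \<pi>"
  shows "set_pmf (\<pi> s) \<subseteq> tight M s"
proof
  fix a assume a: "a \<in> set_pmf (\<pi> s)"
  have "(\<Sum>b\<in>UNIV. pmf (\<pi> s) b * (v_opt M s - Q_opt M s b)) = 0"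
    using v_pol_eq[of \<pi> s] Q_opt_eq[OF opt] v_opt_eq[OF opt]
    by (simp add: right_diff_distrib sum_subtractf sum_distrib_right[symmetric] sum_pmf_UNIV Q_pol_eq)
  then have "pmf (\<pi> s) a * (v_opt M s - Q_opt M s a) = 0"
    using Q_opt_le[OF opt] by (subst (asm) sum_nonneg_eq_0_iff) auto
  with a show "a \<in> tight M s"
    by (simp add: set_pmf_iff tight_def)
qed

end

section \<open>Concentration of the empirical loss\<close>

text \<open>The entries are independent, so the exponential moment of their sum factors.\<close>

lemma nn_integral_replicate_pmf_exp:
  "(\<integral>\<^sup>+xs. ennreal (exp (sum_list (map g xs))) \<partial>replicate_pmf n p)
     = (\<integral>\<^sup>+x. ennreal (exp (g x)) \<partial>p) ^ n"
  by (induction n) (simp_all add: exp_add ennreal_mult nn_integral_cmult nn_integral_multc)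

text \<open>Chernoff's bound, with each factor of the exponential moment estimated by Hoeffding's
  lemma on an interval of length \<open>2 * c\<close>. Only the upper tail is needed.\<close>

lemma Hoeffding_replicate_pmf:
  fixes f :: "'x \<Rightarrow> real"
  assumes bnd: "\<And>x. x \<in> set_pmf p \<Longrightarrow> \<bar>f x\<bar> \<le> c" and c: "c > 0" and t: "t > 0"
  shows "measure_pmf.prob (replicate_pmf n p)
      {xs. sum_list (map f xs) - real n * measure_pmf.expectation p f \<ge> real n * t}
    \<le> exp (- real n * t\<^sup>2 / (2 * c\<^sup>2))" (is "measure_pmf.prob _ {xs. ?dev xs \<ge> _} \<le> _")
proof -
  interpret interval_bounded_random_variable "measure_pmf p" f "-c" c
    by unfold_locales (use bnd in \<open>auto simp: AE_measure_pmf_iff abs_le_iff minus_le_iff\<close>)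
  \<comment> \<open>The minimizer of the exponent
    \<open>- l * n * t + n * l\<^sup>2 * c\<^sup>2 / 2\<close>.\<close>
  define l where "l = t / c\<^sup>2"
  have l: "l > 0" using c t by (simp add: l_def)
  let ?m = "measure_pmf.expectation p f"
  have "ennreal (measure_pmf.prob (replicate_pmf n p) {xs. ?dev xs \<ge> real n * t})
      = emeasure (replicate_pmf n p) {xs \<in> space (replicate_pmf n p). ?dev xs \<ge> real n * t}"
    by (simp add: measure_pmf.emeasure_eq_measure)
  also have "\<dots> \<le> ennreal (exp (- l * (real n * t))) *
      (\<integral>\<^sup>+xs\<in>space (replicate_pmf n p). ennreal (exp (l * ?dev xs)) \<partial>replicate_pmf n p)"
    by (intro Chernoff_ineq_nn_integral_ge l) auto
  \<comment> \<open>Almost every list has length \<open>n\<close>, so \<open>n\<close> times the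
    mean can be distributed over its entries, centering each one.\<close>
  also have "(\<integral>\<^sup>+xs\<in>space (replicate_pmf n p). ennreal (exp (l * ?dev xs)) \<partial>replicate_pmf n p)
     = (\<integral>\<^sup>+xs. ennreal (exp (sum_list (map (\<lambda>x. l * (f x - ?m)) xs))) \<partial>replicate_pmf n p)"
    by (intro nn_integral_cong_AE)
      (auto simp: AE_measure_pmf_iff set_replicate_pmf sum_list_const_mult sum_list_subtractf
        sum_list_triv)
  also have "\<dots> = (\<integral>\<^sup>+x. ennreal (exp (l * (f x - ?m))) \<partial>p) ^ n"
    by (rule nn_integral_replicate_pmf_exp)
  also have "\<dots> \<le> ennreal (exp (l\<^sup>2 * (c - - c)\<^sup>2 / 8)) ^ n"
    by (intro power_mono Hoeffdings_lemma_nn_integral l) auto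
  also have "ennreal (exp (- l * (real n * t))) * \<dots>
      = ennreal (exp (- l * (real n * t) + real n * (l\<^sup>2 * (c - - c)\<^sup>2 / 8)))"
    by (simp add: ennreal_power flip: ennreal_mult exp_of_nat_mult exp_add)
  also have "- l * (real n * t) + real n * (l\<^sup>2 * (c - - c)\<^sup>2 / 8) = - real n * t\<^sup>2 / (2 * c\<^sup>2)"
    using c by (simp add: l_def field_simps power2_eq_square)
  finally show ?thesis by (simp add: mult_left_mono)
qed

section \<open>The empirical Lagrangian as an average of i.i.d. terms with mean
  \<open>loss\<close>\<close>

definition sample_loss ::
  "('s::finite, 'a::finite) mdp \<Rightarrow> ('s \<Rightarrow> 'a \<Rightarrow> real) \<Rightarrow> ('s \<Rightarrow> real) \<Rightarrow> ('s, 'a) sample \<Rightarrow> real" where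
  "sample_loss M w v = (\<lambda>(s, a, s', x).
     - x * w s a + w s a * (v s - disc M * v s') - (1 - disc M) * v s)"

lemma mu_emp_sum_list: "mu_emp D s = (\<Sum>(z, a, s', x)\<leftarrow>D. of_bool (z = s)) / real (length D)"
proof -
  have "(\<Sum>x\<leftarrow>D. of_bool (fst x = s)) = real (card {i. i < length D \<and> fst (D ! i) = s})"
    by (simp add: sum_list_sum_nth atLeast0LessThan sum.If_cases of_bool_def Int_def)
  then show ?thesis by (simp add: mu_emp_def case_prod_unfold)
qed

text \<open>Summing over states inside the sum over samples, the indicators pick out
  \<open>v\<close> at the current and at the next state.\<close>

lemma loss_emp_eq: "loss_emp M D w v = sum_list (map (sample_loss M w v) D) / real (length D)"
proof -
  let ?N = "real (length D)"
  have "(\<Sum>s\<in>UNIV. v s * ((\<Sum>(z, a, s', x)\<leftarrow>D. w z a * (of_bool (z = s) - disc M * of_bool (s' = s)))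
        - (1 - disc M) * (\<Sum>(z, a, s', x)\<leftarrow>D. of_bool (z = s))))
     = (\<Sum>(z, a, s', x)\<leftarrow>D. w z a * (v z - disc M * v s') - (1 - disc M) * v z)"
  proof (induction D)
    case (Cons y D)
    obtain z a s' x where y: "y = (z, a, s', x)" by (cases y) auto
    have ob: "(\<Sum>s\<in>UNIV. v s * of_bool (q = s)) = v q" for q
      by (simp add: of_bool_def if_distrib[of "\<lambda>c. _ * c"] cong: if_cong)
    have "(\<Sum>s\<in>UNIV. v s * (w z a * (of_bool (z = s) - disc M * of_bool (s' = s))
           - (1 - disc M) * of_bool (z = s)))
        = w z a * (\<Sum>s\<in>UNIV. v s * of_bool (z = s))
          - w z a * disc M * (\<Sum>s\<in>UNIV. v s * of_bool (s' = s))
          - (1 - disc M) * (\<Sum>s\<in>UNIV. v s * of_bool (z = s))"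
      unfolding sum_distrib_left sum_subtractf[symmetric]
      by (intro sum.cong refl) (simp add: algebra_simps)
    then have 1: "(\<Sum>s\<in>UNIV. v s * (w z a * (of_bool (z = s) - disc M * of_bool (s' = s))
           - (1 - disc M) * of_bool (z = s)))
        = w z a * (v z - disc M * v s') - (1 - disc M) * v z"
      unfolding ob by (simp add: algebra_simps)
    show ?case
      unfolding y list.map sum_list.Cons prod.case Cons.IH[symmetric] 1[symmetric]
        sum.distrib[symmetric]
      by (intro sum.cong refl) (simp add: algebra_simps)
  qed simp
  note * = this
  have split: "sum_list (map (sample_loss M w v) D) = - (\<Sum>(s, a, s', x)\<leftarrow>D. x * w s a)
      + (\<Sum>(z, a, s', x)\<leftarrow>D. w z a * (v z - disc M * v s') - (1 - disc M) * v z)"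
    by (induction D) (auto simp: sample_loss_def)
  \<comment> \<open>For the empty dataset both sides are 0, by the convention that division by zero
    gives zero.\<close>
  have sc: "(\<Sum>s\<in>UNIV. v s * (X s / ?N - (1 - disc M) * (Y s / ?N)))
      = (\<Sum>s\<in>UNIV. v s * (X s - (1 - disc M) * Y s)) / ?N" for X Y
    unfolding sum_divide_distrib by (intro sum.cong refl)
      (cases "length D = 0"; simp add: field_simps)
  have "loss_emp M D w v = (- (\<Sum>(s, a, s', x)\<leftarrow>D. x * w s a) + (\<Sum>s\<in>UNIV. v s *
      ((\<Sum>(z, a, s', x)\<leftarrow>D. w z a * (of_bool (z = s) - disc M * of_bool (s' = s)))
        - (1 - disc M) * (\<Sum>(z, a, s', x)\<leftarrow>D. of_bool (z = s))))) / ?N"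
    unfolding loss_emp_def u_emp_def K_emp_def mu_emp_sum_list sc
    by (simp add: diff_divide_distrib)
  also have "\<dots> = sum_list (map (sample_loss M w v) D) / ?N"
    unfolding * split[symmetric] ..
  finally show ?thesis .
qed

lemma pmf_state_marg:
  "pmf (state_marg (\<mu> :: ('s::finite \<times> 'a::finite) pmf)) s = (\<Sum>a\<in>UNIV. pmf \<mu> (s, a))"
proof -
  have "fst -` {s} = Pair s ` (UNIV :: 'a set)" by auto
  then show ?thesis
    by (simp add: state_marg_def pmf_map measure_measure_pmf_finite sum.reindex inj_on_def)
qed

lemma finite_set_sample_law: "finite (set_pmf (sample_law M (\<mu> :: ('s::finite \<times> 'a::finite) pmf)))"
  by (auto simp: sample_law_def)

lemma expectation_sample_law:
  fixes \<mu> :: "('s::finite \<times> 'a::finite) pmf" and f :: "('s, 'a) sample \<Rightarrow> real"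
  shows "measure_pmf.expectation (sample_law M \<mu>) f
    = (\<Sum>s\<in>UNIV. \<Sum>a\<in>UNIV. pmf \<mu> (s, a) *
        (\<Sum>s'\<in>UNIV. pmf (trans_prob M s a) s' * f (s, a, s', rew M s a)))"
  unfolding sample_law_def case_prod_unfold
  by (simp add: pmf_expectation_bind[of UNIV] sum_prod_finite)

text \<open>Exchanging sums moves the transition operator from \<open>w\<close> to \<open>v\<close>,
  so the coefficient of \<open>w s a * pmf \<mu> (s, a)\<close> becomes a Bellman residual of
  \<open>v\<close>.\<close>

lemma loss_eq_bellman_Q:
  "loss M \<mu> w v = (\<Sum>s\<in>UNIV. \<Sum>a\<in>UNIV. w s a * pmf \<mu> (s, a) * (v s - bellman_Q M v s a))
     - (1 - disc M) * (\<Sum>s\<in>UNIV. pmf (state_marg \<mu>) s * v s)"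
proof -
  let ?P = "\<lambda>z a s. pmf (trans_prob M z a) s"
  have "(\<Sum>s\<in>UNIV. v s * (\<Sum>z\<in>UNIV. \<Sum>a\<in>UNIV. ?P z a s * w z a * pmf \<mu> (z, a)))
      = (\<Sum>s\<in>UNIV. \<Sum>z\<in>UNIV. \<Sum>a\<in>UNIV. w z a * pmf \<mu> (z, a) * (?P z a s * v s))"
    by (simp add: sum_distrib_left mult_ac)
  also have "\<dots> = (\<Sum>z\<in>UNIV. \<Sum>s\<in>UNIV. \<Sum>a\<in>UNIV. w z a * pmf \<mu> (z, a) * (?P z a s * v s))"
    by (rule sum.swap)
  also have "\<dots> = (\<Sum>z\<in>UNIV. \<Sum>a\<in>UNIV. w z a * pmf \<mu> (z, a) * (\<Sum>s\<in>UNIV. ?P z a s * v s))"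
    unfolding sum_distrib_left by (intro sum.cong refl) (rule sum.swap)
  finally have "(\<Sum>s\<in>UNIV. v s * (\<Sum>z\<in>UNIV. \<Sum>a\<in>UNIV. ?P z a s * w z a * pmf \<mu> (z, a)))
      = (\<Sum>z\<in>UNIV. \<Sum>a\<in>UNIV. w z a * pmf \<mu> (z, a) * (\<Sum>s\<in>UNIV. ?P z a s * v s))" .
  moreover have "loss M \<mu> w v = - (\<Sum>s\<in>UNIV. \<Sum>a\<in>UNIV. w s a * pmf \<mu> (s, a) * rew M s a)
      + (\<Sum>s\<in>UNIV. \<Sum>a\<in>UNIV. w s a * pmf \<mu> (s, a) * v s)
      - disc M * (\<Sum>s\<in>UNIV. v s * (\<Sum>z\<in>UNIV. \<Sum>a\<in>UNIV. ?P z a s * w z a * pmf \<mu> (z, a)))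
      - (1 - disc M) * (\<Sum>s\<in>UNIV. pmf (state_marg \<mu>) s * v s)"
    unfolding loss_def K_pop_def u_pop_def right_diff_distrib sum_subtractf
    by (simp add: sum_distrib_left mult_ac)
  ultimately show ?thesis
    by (simp add: bellman_Q_def distrib_left right_diff_distrib sum.distrib sum_subtractf
        sum_distrib_left mult_ac)
qed

lemma expectation_sample_loss: "measure_pmf.expectation (sample_law M \<mu>) (sample_loss M w v) = loss M \<mu> w v"
proof -
  have "(\<Sum>s'\<in>UNIV. pmf (trans_prob M s a) s' * sample_loss M w v (s, a, s', rew M s a))
      = w s a * (v s - bellman_Q M v s a) - (1 - disc M) * v s" for s a
  proof -
    have "(\<Sum>s'\<in>UNIV. pmf (trans_prob M s a) s' * sample_loss M w v (s, a, s', rew M s a))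
      = (\<Sum>s'\<in>UNIV. pmf (trans_prob M s a) s') * (- rew M s a * w s a + w s a * v s - (1 - disc M) * v s)
        - w s a * disc M * (\<Sum>s'\<in>UNIV. pmf (trans_prob M s a) s' * v s')"
      unfolding sample_loss_def sum_distrib_left sum_distrib_right sum_subtractf[symmetric]
      by (intro sum.cong refl) (simp add: algebra_simps)
    then show ?thesis
      by (simp add: sum_pmf_UNIV bellman_Q_def algebra_simps)
  qed
  moreover have "(\<Sum>s\<in>UNIV. pmf (state_marg \<mu>) s * v s) = (\<Sum>s\<in>UNIV. \<Sum>a\<in>UNIV. pmf \<mu> (s, a) * v s)"
    by (simp add: pmf_state_marg sum_distrib_right)
  moreover have "(\<Sum>s\<in>UNIV. \<Sum>a\<in>UNIV. pmf \<mu> (s, a) * (w s a * X s a - c * v s))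
      = (\<Sum>s\<in>UNIV. \<Sum>a\<in>UNIV. w s a * pmf \<mu> (s, a) * X s a)
        - c * (\<Sum>s\<in>UNIV. \<Sum>a\<in>UNIV. pmf \<mu> (s, a) * v s)" for X c
    by (simp add: right_diff_distrib sum_subtractf sum_distrib_left mult_ac)
  ultimately show ?thesis
    unfolding expectation_sample_law loss_eq_bellman_Q by simp
qed

text \<open>With \<gamma> the discount, the factor multiplying \<open>w s a\<close> is at most 1 +
  (1 + \<gamma>)/(1 - \<gamma>) = 2/(1 - \<gamma>) in absolute value; the remaining term
  \<open>(1 - disc M) * v s\<close> is at most 1.\<close>

lemma sample_loss_bound:
  assumes "mdp M" and z: "z \<in> set_pmf (sample_law M \<mu>)"
    and w: "\<And>s a. \<bar>w s a\<bar> \<le> B" and v: "\<And>s. \<bar>v s\<bar> \<le> 1 / (1 - disc M)"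
  shows "\<bar>sample_loss M w v z\<bar> \<le> 2 * B / (1 - disc M) + 1"
proof -
  note [simp] = disc_bounds[OF \<open>mdp M\<close>] rew_bounds[OF \<open>mdp M\<close>]
  obtain s a s' where z: "z = (s, a, s', rew M s a)"
    using z by (auto simp: sample_law_def)
  let ?V = "1 / (1 - disc M)"
  have g: "\<bar>disc M * v s'\<bar> \<le> disc M * ?V"
    using mult_left_mono[OF v[of s'], of "disc M"] by (simp add: abs_mult)
  have "\<bar>- rew M s a + (v s - disc M * v s')\<bar> \<le> 1 + (?V + disc M * ?V)"
    using g v[of s] rew_bounds[OF \<open>mdp M\<close>, of s a] by linarith
  also have "\<dots> = 2 / (1 - disc M)"
    using less_imp_neq[OF disc_bounds(2)[OF \<open>mdp M\<close>]] by (simp add: field_simps)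
  finally have "\<bar>w s a\<bar> * \<bar>- rew M s a + (v s - disc M * v s')\<bar> \<le> B * (2 / (1 - disc M))"
    using w[of s a] by (intro mult_mono) auto
  then have "\<bar>w s a * (- rew M s a + (v s - disc M * v s'))\<bar> \<le> 2 * B / (1 - disc M)"
    by (simp add: abs_mult mult_ac)
  moreover have "(1 - disc M) * \<bar>v s\<bar> \<le> (1 - disc M) * ?V"
    using disc_bounds[OF \<open>mdp M\<close>] by (intro mult_left_mono v) linarith
  then have "\<bar>(1 - disc M) * v s\<bar> \<le> 1"
    using disc_bounds(2)[OF \<open>mdp M\<close>] by (simp add: abs_mult abs_of_pos)
  moreover have "sample_loss M w v z
      = w s a * (- rew M s a + (v s - disc M * v s')) - (1 - disc M) * v s"
    by (simp add: z sample_loss_def algebra_simps)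
  ultimately show ?thesis
    by linarith
qed

section \<open>Policies extracted from weights\<close>

text \<open>Let \<open>m\<close> be the mass of \<open>X\<close>. Conditioning raises each mass on
  \<open>X\<close> by the factor \<open>1 / m\<close>, a total gain of \<open>1 - m\<close>, and the
  masses it removes outside \<open>X\<close> only lower the difference because \<open>q\<close> is
  nonnegative.\<close>

lemma cond_pmf_diff_le:
  fixes p :: "'x::finite pmf"
  assumes ne: "set_pmf p \<inter> X \<noteq> {}" and q: "\<And>x. 0 \<le> q x" "\<And>x. q x \<le> c"
  shows "(\<Sum>x\<in>UNIV. pmf (cond_pmf p X) x * q x) - (\<Sum>x\<in>UNIV. pmf p x * q x)
    \<le> c * measure_pmf.prob p (- X)"
proof -
  define m where "m = measure_pmf.prob p X"
  have m: "0 < m" "m \<le> 1"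
    using ne measure_pmf_posI[of _ p X] by (auto simp: m_def)
  have "(\<Sum>x\<in>UNIV. pmf (cond_pmf p X) x * q x) - (\<Sum>x\<in>UNIV. pmf p x * q x)
      = (\<Sum>x\<in>UNIV. (pmf (cond_pmf p X) x - pmf p x) * q x)"
    by (simp add: sum_subtractf left_diff_distrib)
  also have "\<dots> \<le> (\<Sum>x\<in>UNIV. if x \<in> X then c * (1 / m - 1) * pmf p x else 0)"
  proof (intro sum_mono)
    fix x
    show "(pmf (cond_pmf p X) x - pmf p x) * q x
        \<le> (if x \<in> X then c * (1 / m - 1) * pmf p x else 0)"
    proof (cases "x \<in> X")
      case True
      have "(1 / m - 1) * pmf p x * q x \<le> (1 / m - 1) * pmf p x * c"
        using m by (intro mult_left_mono q mult_nonneg_nonneg) auto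
      then show ?thesis
        using True by (simp add: pmf_cond[OF ne] m_def algebra_simps)
    qed (simp add: pmf_cond[OF ne] q)
  qed
  also have "\<dots> = c * (1 / m - 1) * m"
    by (simp add: sum.If_cases m_def measure_measure_pmf_finite sum_distrib_left)
  also have "\<dots> = c * (1 - m)"
    using m by (simp add: field_simps)
  also have "1 - m = measure_pmf.prob p (- X)"
    by (simp add: m_def measure_pmf.prob_compl[symmetric] Compl_eq_Diff_UNIV)
  finally show ?thesis .
qed

lemma gap_Q_bounds:
  assumes "mdp M" "optimal M \<pi>" "inactive M \<noteq> {}"
  shows "gap_Q M > 0" and "a \<notin> tight M s \<Longrightarrow> gap_Q M \<le> v_opt M s - Q_opt M s a"
proof -
  let ?g = "\<lambda>(s, a). v_opt M s - Q_opt M s a"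
  have "gap_Q M \<in> ?g ` inactive M"
    unfolding gap_Q_def by (intro Min_in) (use assms(3) in auto)
  then show "gap_Q M > 0"
    using Q_opt_le[OF assms(1,2)] by (force simp: inactive_def less_le)
  show "gap_Q M \<le> v_opt M s - Q_opt M s a" if "a \<notin> tight M s"
    unfolding gap_Q_def by (intro Min_le) (use that in \<open>force simp: inactive_def tight_def\<close>)+
qed

section \<open>Feasible weights and the policies they induce\<close>

lemma behav_nonneg: "0 \<le> behav \<mu> s a"
  by (simp add: behav_def)

text \<open>At a state without data the row of \<open>behav\<close> is zero, which contradicts the
  positive lower bound \<open>1 - disc M\<close>. So one feasible weight forces the state marginal
  to have full support.\<close>

lemma weights_state_marg_pos:
  assumes "mdp M" "w \<in> weights M \<mu>"
  shows "0 < pmf (state_marg \<mu>) s"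
proof (rule ccontr)
  assume "\<not> 0 < pmf (state_marg \<mu>) s"
  then have "(\<Sum>a\<in>UNIV. w s a * behav \<mu> s a) = 0"
    by (simp add: behav_def)
  then show False
    using assms disc_bounds[OF assms(1)] by (auto simp: weights_def dest!: spec[of _ s])
qed

text \<open>For feasible weights the normalizer is at least \<open>1 - disc M > 0\<close>, so the
  uniform default never occurs.\<close>

lemma pmf_weight_policy:
  assumes "mdp M" "w \<in> weights M \<mu>"
  shows "pmf (weight_policy \<mu> w s) a = w s a * behav \<mu> s a / (\<Sum>b\<in>UNIV. w s b * behav \<mu> s b)"
proof -
  define Z where "Z = (\<Sum>b\<in>UNIV. w s b * behav \<mu> s b)"
  have "1 - disc M \<le> Z"
    using assms by (simp add: weights_def Z_def)
  then have Z: "Z > 0"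
    using disc_bounds[OF assms(1)] by simp
  have nn: "0 \<le> w s b * behav \<mu> s b / Z" for b
    using assms Z by (simp add: weights_def behav_nonneg)
  have "(\<Sum>b\<in>UNIV. w s b * behav \<mu> s b / Z) = 1"
    using Z by (simp add: Z_def flip: sum_divide_distrib)
  then have "(\<integral>\<^sup>+b. ennreal (w s b * behav \<mu> s b / Z) \<partial>count_space UNIV) = 1"
    using nn by (simp add: nn_integral_count_space_finite)
  then have "pmf (embed_pmf (\<lambda>b. w s b * behav \<mu> s b / Z)) a = w s a * behav \<mu> s a / Z"
    by (intro pmf_embed_pmf nn)
  moreover have "weight_policy \<mu> w s = embed_pmf (\<lambda>b. w s b * behav \<mu> s b / Z)"
    using Z by (simp add: weight_policy_def Z_def[symmetric])
  ultimately show ?thesis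
    by (simp add: Z_def)
qed

text \<open>Multiplied by the state marginal, \<open>behav\<close> becomes \<open>\<mu>\<close>, so
  the mass of an inactive action is \<open>w s a * pmf \<mu> (s, a)\<close> over the normalizer. The
  factor \<open>1 - disc M\<close> absorbs the normalizer, and each inactive action costs at least
  \<open>gap_Q M\<close>.\<close>

lemma prob_not_tight_weight_policy_le:
  assumes M: "mdp M" and opt: "optimal M \<pi>" and ne: "inactive M \<noteq> {}" and w: "w \<in> weights M \<mu>"
  shows "gap_Q M * (1 - disc M) * (pmf (state_marg \<mu>) s *
      measure_pmf.prob (weight_policy \<mu> w s) (- tight M s))
    \<le> (\<Sum>a\<in>UNIV. w s a * pmf \<mu> (s, a) * (v_opt M s - Q_opt M s a))"
proof -
  let ?m = "pmf (state_marg \<mu>) s"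
  have m: "?m > 0" using weights_state_marg_pos[OF M w] .
  define Z where "Z = (\<Sum>b\<in>UNIV. w s b * behav \<mu> s b)"
  have Z: "Z \<ge> 1 - disc M" and w0: "\<And>a. 0 \<le> w s a"
    using w by (auto simp: weights_def Z_def)
  define g where "g = 1 - disc M"
  have g: "0 < g" "g \<le> Z" using Z disc_bounds[OF M] by (auto simp: g_def)
  have "g * (?m * measure_pmf.prob (weight_policy \<mu> w s) (- tight M s))
      = (\<Sum>a\<in>- tight M s. g * ?m * (w s a * behav \<mu> s a / Z))"
    by (simp add: measure_measure_pmf_finite pmf_weight_policy[OF M w] Z_def sum_distrib_left mult.assoc)
  also have "\<dots> \<le> (\<Sum>a\<in>- tight M s. w s a * pmf \<mu> (s, a))"
  proof (intro sum_mono)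
    fix a
    have "g * ?m * (w s a * behav \<mu> s a / Z) = (g / Z) * (w s a * pmf \<mu> (s, a))"
      using m by (simp add: behav_def)
    also have "\<dots> \<le> 1 * (w s a * pmf \<mu> (s, a))"
      using g w0 by (intro mult_right_mono) auto
    finally show "g * ?m * (w s a * behav \<mu> s a / Z) \<le> w s a * pmf \<mu> (s, a)" by simp
  qed
  finally have "gap_Q M * (g * (?m * measure_pmf.prob (weight_policy \<mu> w s) (- tight M s)))
      \<le> gap_Q M * (\<Sum>a\<in>- tight M s. w s a * pmf \<mu> (s, a))"
    using gap_Q_bounds(1)[OF M opt ne] by (intro mult_left_mono) auto
  also have "\<dots> = (\<Sum>a\<in>- tight M s. w s a * pmf \<mu> (s, a) * gap_Q M)"
    by (simp add: sum_distrib_left mult.commute)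
  also have "\<dots> \<le> (\<Sum>a\<in>- tight M s. w s a * pmf \<mu> (s, a) * (v_opt M s - Q_opt M s a))"
    by (intro sum_mono mult_left_mono gap_Q_bounds(2)[OF M opt ne] mult_nonneg_nonneg w0) auto
  also have "\<dots> \<le> (\<Sum>a\<in>UNIV. w s a * pmf \<mu> (s, a) * (v_opt M s - Q_opt M s a))"
    using Q_opt_le[OF M opt] by (intro sum_mono2) (auto simp: w0)
  finally show ?thesis by (simp add: g_def mult.assoc)
qed

text \<open>The comparator is an optimal policy \<open>\<pi>'\<close> built from the weight policy
  itself and having the same \<open>J\<close> as \<open>\<pi>\<close>; \<open>conc\<close> is
  applied to its occupancy. One factor \<open>1 / (1 - disc M)\<close> is the range of
  \<open>Q_pol\<close>, the other comes from the normalizer of the weights.\<close>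

lemma weight_policy_suboptimality:
  assumes M: "mdp M" and opt: "mu_optimal M \<mu> \<pi>" and ne: "inactive M \<noteq> {}"
    and w: "w \<in> weights M \<mu>" and C: "0 \<le> C"
    and conc: "\<And>\<pi>' s. mu_optimal M \<mu> \<pi>' \<Longrightarrow>
      occ_state M \<pi>' (state_marg \<mu>) s \<le> C * pmf (state_marg \<mu>) s"
  shows "J M (state_marg \<mu>) \<pi> - J M (state_marg \<mu>) (weight_policy \<mu> w)
    \<le> C / (gap_Q M * (1 - disc M)\<^sup>2) *
        (\<Sum>s\<in>UNIV. \<Sum>a\<in>UNIV. w s a * pmf \<mu> (s, a) * (v_opt M s - Q_opt M s a))"
proof -
  have o: "optimal M \<pi>" and mu: "mu_policy \<mu> \<pi>"
    using opt by (auto simp: mu_optimal_def)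
  let ?\<rho> = "state_marg \<mu>" and ?p = "weight_policy \<mu> w"
  \<comment> \<open>Conditioning is impossible where the weight policy plays no active action; there
    \<open>\<pi>\<close> is copied, whose actions are active by
    \<open>tight_if_optimal\<close>.\<close>
  define \<pi>' where "\<pi>' s = (if set_pmf (?p s) \<inter> tight M s = {} then \<pi> s
      else cond_pmf (?p s) (tight M s))" for s
  have "optimal M \<pi>'"
    using tight_if_optimal[OF M o] by (intro optimal_if_tight[OF M o]) (auto simp: \<pi>'_def)
  have "mu_policy \<mu> \<pi>'"
    unfolding mu_policy_def
  proof (intro ballI allI impI)
    fix s a assume s: "s \<in> data_states \<mu>" and a: "pmf (\<pi>' s) a > 0"
    show "pmf \<mu> (s, a) > 0"
    proof (cases "set_pmf (?p s) \<inter> tight M s = {}")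
      case True
      then show ?thesis using mu s a by (simp add: \<pi>'_def mu_policy_def)
    next
      case False
      then have "pmf (?p s) a \<noteq> 0"
        using a by (auto simp: \<pi>'_def pmf_cond split: if_splits)
      then show ?thesis
        by (auto simp: pmf_weight_policy[OF M w] behav_def pmf_nonneg less_le split: if_splits)
    qed
  qed
  with \<open>optimal M \<pi>'\<close> have opt': "mu_optimal M \<mu> \<pi>'"
    by (simp add: mu_optimal_def)
  define g where "g = 1 - disc M"
  have g: "g > 0" using disc_bounds[OF M] by (simp add: g_def)
  define e where "e s = measure_pmf.prob (?p s) (- tight M s)" for s
  have e0: "0 \<le> e s" for s by (simp add: e_def)
  have diff: "(\<Sum>a\<in>UNIV. pmf (\<pi>' s) a * (Q_pol M ?p s a - v_pol M ?p s)) \<le> 1 / g * e s" for s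
  proof -
    have "(\<Sum>a\<in>UNIV. pmf (\<pi>' s) a * (Q_pol M ?p s a - v_pol M ?p s))
        = (\<Sum>a\<in>UNIV. pmf (\<pi>' s) a * Q_pol M ?p s a) - v_pol M ?p s"
      by (simp add: right_diff_distrib sum_subtractf sum_pmf_UNIV flip: sum_distrib_right)
    also have "\<dots> \<le> 1 / g * e s"
    proof (cases "set_pmf (?p s) \<inter> tight M s = {}")
      case False
      then show ?thesis
        using cond_pmf_diff_le[OF False, of "Q_pol M ?p s" "1 / g"] Q_pol_bounds[OF M]
        by (simp add: \<pi>'_def v_pol_eq[OF M] g_def e_def)
    next
      case True
      \<comment> \<open>In the fallback case the inactive mass is 1, so the trivial bound
        \<open>1 / g\<close> on \<open>Q_pol\<close> suffices.\<close>
      then have "measure_pmf.prob (?p s) (- tight M s) = 1"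
        by (subst measure_pmf.prob_eq_1) (auto simp: AE_measure_pmf_iff)
      moreover have "(\<Sum>a\<in>UNIV. pmf (\<pi>' s) a * Q_pol M ?p s a) \<le> (\<Sum>a\<in>UNIV. pmf (\<pi>' s) a * (1 / g))"
        unfolding g_def by (intro sum_mono mult_left_mono Q_pol_bounds[OF M]) auto
      ultimately show ?thesis
        using v_pol_bounds(1)[OF M, of ?p s]
        by (simp add: e_def sum_pmf_UNIV flip: sum_divide_distrib)
    qed
    finally show ?thesis .
  qed
  have "J M ?\<rho> \<pi> = J M ?\<rho> \<pi>'"
    using v_opt_eq[OF M o] v_opt_eq[OF M \<open>optimal M \<pi>'\<close>] by (simp add: J_eq_v_pol[OF M])
  \<comment> \<open>Performance difference identity: \<open>occ_flow_dual\<close> for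
    \<open>\<pi>'\<close>, tested against the value of the weight policy.\<close>
  then have "J M ?\<rho> \<pi> - J M ?\<rho> ?p = (\<Sum>s\<in>UNIV. \<Sum>a\<in>UNIV. occ M \<pi>' ?\<rho> s a *
      (Q_pol M ?p s a - v_pol M ?p s))"
    using occ_flow_dual[OF M, of \<pi>' ?\<rho> "v_pol M ?p"]
    by (simp add: J_eq_v_pol[OF M, of _ ?p] Q_pol_eq[OF M])
  also have "\<dots> = (\<Sum>s\<in>UNIV. occ_state M \<pi>' ?\<rho> s *
      (\<Sum>a\<in>UNIV. pmf (\<pi>' s) a * (Q_pol M ?p s a - v_pol M ?p s)))"
    by (simp add: occ_eq_occ_state[OF M] sum_distrib_left mult_ac)
  also have "\<dots> \<le> (\<Sum>s\<in>UNIV. (C * pmf ?\<rho> s) * (1 / g * e s))"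
  proof (intro sum_mono)
    fix s
    have "occ_state M \<pi>' ?\<rho> s * (\<Sum>a\<in>UNIV. pmf (\<pi>' s) a * (Q_pol M ?p s a - v_pol M ?p s))
        \<le> occ_state M \<pi>' ?\<rho> s * (1 / g * e s)"
      by (intro mult_left_mono diff occ_state_nonneg[OF M])
    also have "\<dots> \<le> (C * pmf ?\<rho> s) * (1 / g * e s)"
      using g e0 by (intro mult_right_mono conc[OF opt']) auto
    finally show "occ_state M \<pi>' ?\<rho> s * (\<Sum>a\<in>UNIV. pmf (\<pi>' s) a * (Q_pol M ?p s a - v_pol M ?p s))
        \<le> (C * pmf ?\<rho> s) * (1 / g * e s)" .
  qed
  also have "\<dots> = C / (gap_Q M * g\<^sup>2) * (\<Sum>s\<in>UNIV. gap_Q M * g * (pmf ?\<rho> s * e s))"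
    unfolding sum_distrib_left
    using g gap_Q_bounds(1)[OF M o ne]
    by (intro sum.cong) (simp_all add: field_simps power2_eq_square)
  also have "\<dots> \<le> C / (gap_Q M * g\<^sup>2) *
      (\<Sum>s\<in>UNIV. \<Sum>a\<in>UNIV. w s a * pmf \<mu> (s, a) * (v_opt M s - Q_opt M s a))"
    unfolding g_def e_def
    using gap_Q_bounds(1)[OF M o ne] C
    by (intro mult_left_mono sum_mono prob_not_tight_weight_policy_le[OF M o ne w]) auto
  finally show ?thesis by (simp add: g_def)
qed

text \<open>The density of the occupancy measure of \<open>\<pi>\<close> with respect to
  \<open>\<mu>\<close> is feasible, and by the flow equation its loss is \<open>- J\<close> for
  every dual variable. The solution \<open>w\<close> is compared with this density.\<close>

lemma loss_minmax_solution_le: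
  assumes M: "mdp M" and pos: "\<And>s. 0 < pmf (state_marg \<mu>) s"
    and conc: "\<And>s a. occ M \<pi> (state_marg \<mu>) s a \<le> C * pmf \<mu> (s, a)"
    and sol: "minmax_solution (loss M \<mu>) (weights M \<mu>) UNIV w"
  shows "loss M \<mu> w v \<le> - J M (state_marg \<mu>) \<pi>"
proof -
  let ?\<rho> = "state_marg \<mu>"
  define w0 where "w0 s a = occ M \<pi> ?\<rho> s a / pmf \<mu> (s, a)" for s a
  \<comment> \<open>Where \<open>pmf \<mu> (s, a)\<close> is zero, \<open>conc\<close> forces the
    occupancy to be zero as well, so no mass is lost in the division.\<close>
  have w0: "w0 s a * pmf \<mu> (s, a) = occ M \<pi> ?\<rho> s a" for s a
    using conc[of s a] occ_nonneg[OF M, of \<pi> ?\<rho> s a] by (auto simp: w0_def)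
  have "w0 \<in> weights M \<mu>"
    unfolding weights_def
  proof (intro CollectI conjI allI)
    show "0 \<le> w0 s a" for s a
      by (simp add: w0_def occ_nonneg[OF M])
    fix s
    have "(\<Sum>a\<in>UNIV. w0 s a * behav \<mu> s a) = occ_state M \<pi> ?\<rho> s / pmf ?\<rho> s"
      using pos[of s] by (simp add: behav_def w0 occ_state_def sum_divide_distrib)
    then show "1 - disc M \<le> (\<Sum>a\<in>UNIV. w0 s a * behav \<mu> s a)"
      using occ_state_ge[OF M, of ?\<rho> s \<pi>] pos[of s] by (simp add: pos_le_divide_eq)
  qed
  moreover have "loss M \<mu> w0 v' = - J M ?\<rho> \<pi>" for v'
  proof -
    have "(\<Sum>s\<in>UNIV. \<Sum>a\<in>UNIV. occ M \<pi> ?\<rho> s a * (v' s - bellman_Q M v' s a))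
       = - (\<Sum>s\<in>UNIV. \<Sum>a\<in>UNIV. occ M \<pi> ?\<rho> s a * (bellman_Q M v' s a - v' s))"
      by (simp add: right_diff_distrib sum_subtractf)
    then show ?thesis
      unfolding loss_eq_bellman_Q w0 occ_flow_dual[OF M] by simp
  qed
  ultimately have "(SUP v. ereal (loss M \<mu> w v)) \<le> ereal (- J M ?\<rho> \<pi>)"
    using sol by (auto simp: minmax_solution_def)
  then have "ereal (loss M \<mu> w v) \<le> ereal (- J M ?\<rho> \<pi>)"
    by (rule order.trans[rotated]) (auto intro: SUP_upper)
  then show ?thesis by simp
qed

text \<open>As \<open>V\<close> is finite and contains \<open>v\<close>, the inner supremum at the
  competitor \<open>w'\<close> is attained, which replaces a comparison of suprema by one of two
  real losses.\<close>

lemma minmax_solution_finiteD: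
  assumes "minmax_solution L W V w" "finite V" "v \<in> V" "w' \<in> W"
  obtains v' where "v' \<in> V" "L w v \<le> L w' v'"
proof -
  have "(SUP v\<in>V. ereal (L w' v)) = Max ((\<lambda>v. ereal (L w' v)) ` V)"
    using assms by (intro Max_Sup[symmetric]) auto
  also have "\<dots> \<in> (\<lambda>v. ereal (L w' v)) ` V"
    using assms by (intro Max_in) auto
  finally obtain v' where v': "v' \<in> V" "(SUP v\<in>V. ereal (L w' v)) = ereal (L w' v')"
    by blast
  have "ereal (L w v) \<le> (SUP v\<in>V. ereal (L w v))"
    using assms by (intro SUP_upper)
  also have "\<dots> \<le> (SUP v\<in>V. ereal (L w' v))"
    using assms by (simp add: minmax_solution_def)
  finally show ?thesis
    using v' that by simp
qed

lemma abs_le_sup_norm: "\<bar>w s a\<bar> \<le> sup_norm w"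
  unfolding sup_norm_def by (intro Max_ge) (auto intro: image_eqI[of _ _ "(s, a)"])

text \<open>At any state \<open>behav\<close> is a probability vector, so the average of
  \<open>w\<close> is at most its norm. The bound is used to absorb the additive 1 of
  \<open>sample_loss_bound\<close> into a multiple of
  \<open>B\<^sub>W / (1 - disc M)\<close>.\<close>

lemma weights_sup_norm_ge:
  assumes "mdp M" "w \<in> weights M \<mu>"
  shows "1 - disc M \<le> sup_norm w"
proof -
  fix s
  have "1 - disc M \<le> (\<Sum>a\<in>UNIV. w s a * behav \<mu> s a)"
    using assms by (simp add: weights_def)
  also have "\<dots> \<le> (\<Sum>a\<in>UNIV. sup_norm w * behav \<mu> s a)"
    by (intro sum_mono mult_right_mono behav_nonneg abs_le_D1[OF abs_le_sup_norm])
  also have "\<dots> = sup_norm w * (\<Sum>a\<in>UNIV. behav \<mu> s a)"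
    by (simp add: sum_distrib_left)
  also have "(\<Sum>a\<in>UNIV. behav \<mu> s a) = 1"
    using weights_state_marg_pos[OF assms, of s]
    by (simp add: behav_def pmf_state_marg flip: sum_divide_distrib)
  finally show ?thesis by simp
qed

section \<open>The regret bound\<close>

theorem theorem5:
  fixes M :: "('s::finite, 'a::finite) mdp"
    and \<mu> :: "('s \<times> 'a) pmf"
    and n :: nat
    and \<delta> B\<^sub>W C C\<^sub>m\<^sub>a\<^sub>x :: real
    and W :: "('s \<Rightarrow> 'a \<Rightarrow> real) set"
    and V :: "('s \<Rightarrow> real) set"
    and \<pi>opt :: "('s, 'a) policy"
    and w\<^sub>D :: "('s, 'a) sample list \<Rightarrow> 's \<Rightarrow> 'a \<Rightarrow> real"
  assumes "mdp M"
    and "n \<ge> 1"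
    and "0 < \<delta>" "\<delta> < 1"
    and "B\<^sub>W > 0"
    and "finite W" "W \<subseteq> weights M \<mu>"
    and "finite V"
    and "inactive M \<noteq> {}"
    and "\<exists>w\<in>W. minmax_solution (loss M \<mu>) (weights M \<mu>) UNIV w"
    and "\<forall>w\<in>W. sup_norm w \<le> B\<^sub>W"
    and "v_opt M \<in> V"
    and "\<forall>v\<in>V. \<forall>s. v s \<in> {- 1 / (1 - disc M) .. 1 / (1 - disc M)}"
    and "max_mu_optimal M \<mu> \<pi>opt"
    and "C > 0"
    and "\<forall>s a. occ M \<pi>opt (state_marg \<mu>) s a \<le> C * pmf \<mu> (s, a)"
    and "C\<^sub>m\<^sub>a\<^sub>x > 0"
    and "\<forall>\<pi>. mu_optimal M \<mu> \<pi> \<longrightarrow>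
           (\<forall>s. occ_state M \<pi> (state_marg \<mu>) s \<le> C\<^sub>m\<^sub>a\<^sub>x * pmf (state_marg \<mu>) s)"
    and "\<forall>D\<in>set_pmf (data_law M \<mu> n). minmax_solution (loss_emp M D) W V (w\<^sub>D D)"
  shows "measure_pmf.prob (data_law M \<mu> n)
           {D. J M (state_marg \<mu>) \<pi>opt - J M (state_marg \<mu>) (weight_policy \<mu> (w\<^sub>D D))
               \<le> 8 * sqrt 2 * B\<^sub>W * C\<^sub>m\<^sub>a\<^sub>x / (gap_Q M * (1 - disc M) ^ 3)
                 * (sqrt (ln (real (card W) * real (card V) / \<delta>)) / sqrt (real n))}
         \<ge> 1 - \<delta>"
proof -
  let ?\<rho> = "state_marg \<mu>"
  note M = \<open>mdp M\<close>
  have opt: "mu_optimal M \<mu> \<pi>opt" and o: "optimal M \<pi>opt"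
    using \<open>max_mu_optimal M \<mu> \<pi>opt\<close> by (auto simp: max_mu_optimal_def mu_optimal_def)
  obtain w\<^sub>0 where w\<^sub>0: "w\<^sub>0 \<in> W" "minmax_solution (loss M \<mu>) (weights M \<mu>) UNIV w\<^sub>0"
    using \<open>\<exists>w\<in>W. minmax_solution (loss M \<mu>) (weights M \<mu>) UNIV w\<close> by blast
  have W: "w \<in> weights M \<mu>" if "w \<in> W" for w
    using that \<open>W \<subseteq> weights M \<mu>\<close> by blast
  define g where "g = 1 - disc M"
  have g: "0 < g" "g \<le> 1" using disc_bounds[OF M] by (auto simp: g_def)
  have gap: "gap_Q M > 0" by (rule gap_Q_bounds(1)[OF M o \<open>inactive M \<noteq> {}\<close>])
  have gB: "g \<le> B\<^sub>W"
    using weights_sup_norm_ge[OF M W[OF w\<^sub>0(1)]] \<open>\<forall>w\<in>W. sup_norm w \<le> B\<^sub>W\<close> w\<^sub>0(1)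
    by (force simp: g_def)
  \<comment> \<open>Bounds a difference of two sample losses: 2 (2x + 1) \<le> 6x for x =
    \<open>B\<^sub>W / g\<close>, which is at least 1 by \<open>gB\<close>.\<close>
  define c where "c = 6 * B\<^sub>W / g"
  have c: "c > 0" using g \<open>B\<^sub>W > 0\<close> by (simp add: c_def)
  define N where "N = real (card W) * real (card V)"
  have "card W \<ge> 1" "card V \<ge> 1"
    using w\<^sub>0(1) \<open>v_opt M \<in> V\<close> \<open>finite W\<close> \<open>finite V\<close>
    by (auto simp: Suc_le_eq card_gt_0_iff)
  then have N: "N \<ge> 1"
    unfolding N_def using mult_mono[of 1 "real (card W)" 1 "real (card V)"] by simp
  define L where "L = ln (N / \<delta>)"
  have L: "L > 0" using N \<open>0 < \<delta>\<close> \<open>\<delta> < 1\<close> by (simp add: L_def)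
  \<comment> \<open>Solves \<open>n * t\<^sup>2 / (2 * c\<^sup>2) = L\<close>, so that each tail
    event has probability at most \<open>\<delta> / N\<close>.\<close>
  define t where "t = c * sqrt (2 * L / real n)"
  have t: "t > 0" using c L \<open>n \<ge> 1\<close> by (simp add: t_def)

  define A where "A w = (\<Sum>s\<in>UNIV. \<Sum>a\<in>UNIV. w s a * pmf \<mu> (s, a) * (v_opt M s - Q_opt M s a))" for w
  \<comment> \<open>The two losses to be compared are put into one variable, with
    \<open>w\<^sub>0\<close> and \<open>v_opt M\<close> fixed. One upper tail per pair
    \<open>(w, v)\<close> then suffices, hence exactly \<open>N\<close> events.\<close>
  define f where "f w v = (\<lambda>z. sample_loss M w\<^sub>0 v z - sample_loss M w (v_opt M) z)" for w v
  have f_bound: "\<bar>f w v z\<bar> \<le> c"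
    if "w \<in> W" "v \<in> V" "z \<in> set_pmf (sample_law M \<mu>)" for w v z
  proof -
    have w: "\<bar>w' s a\<bar> \<le> B\<^sub>W" if "w' \<in> W" for w' s a
      using abs_le_sup_norm[of w' s a] \<open>\<forall>w\<in>W. sup_norm w \<le> B\<^sub>W\<close> that by force
    have v: "\<bar>v' s\<bar> \<le> 1 / (1 - disc M)" if "v' \<in> V" for v' s
      using \<open>\<forall>v\<in>V. \<forall>s. v s \<in> {- 1 / (1 - disc M) .. 1 / (1 - disc M)}\<close> that
      by (auto simp: abs_le_iff minus_le_iff)
    have "\<bar>sample_loss M w\<^sub>0 v z\<bar> \<le> 2 * B\<^sub>W / g + 1" "\<bar>sample_loss M w (v_opt M) z\<bar> \<le> 2 * B\<^sub>W / g + 1"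
      unfolding g_def using that w\<^sub>0(1) \<open>v_opt M \<in> V\<close> by (intro sample_loss_bound[OF M] w v; simp)+
    moreover have "1 \<le> B\<^sub>W / g" using g gB by simp
    ultimately show ?thesis unfolding f_def c_def by (simp add: abs_le_iff)
  qed
  \<comment> \<open>The loss at \<open>(w, v_opt M)\<close> is \<open>A w\<close> above
    \<open>- J\<close>, while the loss at \<open>(w\<^sub>0, v)\<close> is at most
    \<open>- J\<close> for every \<open>v\<close>.\<close>
  have f_mean: "measure_pmf.expectation (sample_law M \<mu>) (f w v) \<le> - A w" if "w \<in> W" for w v
  proof -
    have "measure_pmf.expectation (sample_law M \<mu>) (f w v) = loss M \<mu> w\<^sub>0 v - loss M \<mu> w (v_opt M)"
      unfolding f_def
      by (simp add: expectation_sample_loss integrable_measure_pmf_finite finite_set_sample_law)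
    also have "loss M \<mu> w (v_opt M) = A w - J M ?\<rho> \<pi>opt"
      by (simp add: loss_eq_bellman_Q A_def Q_opt_eq[OF M o] J_eq_v_pol[OF M] v_opt_eq[OF M o])
    also have "loss M \<mu> w\<^sub>0 v \<le> - J M ?\<rho> \<pi>opt"
      using \<open>\<forall>s a. occ M \<pi>opt (state_marg \<mu>) s a \<le> C * pmf \<mu> (s, a)\<close>
      by (intro loss_minmax_solution_le[OF M weights_state_marg_pos[OF M W[OF w\<^sub>0(1)]] _ w\<^sub>0(2)]) auto
    finally show ?thesis by simp
  qed

  define E where "E = (\<lambda>(w, v). {D. sum_list (map (f w v) D)
      - real n * measure_pmf.expectation (sample_law M \<mu>) (f w v) \<ge> real n * t})"
  have tail: "measure_pmf.prob (data_law M \<mu> n) (E z) \<le> \<delta> / N" if zWV: "z \<in> W \<times> V" for z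
  proof -
    obtain w v where z: "z = (w, v)" "w \<in> W" "v \<in> V" using zWV by auto
    have "measure_pmf.prob (data_law M \<mu> n) (E z) \<le> exp (- real n * t\<^sup>2 / (2 * c\<^sup>2))"
      unfolding E_def z(1) prod.case data_law_def
      using f_bound[OF z(2,3)] c t by (intro Hoeffding_replicate_pmf) auto
    also have "- real n * t\<^sup>2 / (2 * c\<^sup>2) = - L"
      using c L \<open>n \<ge> 1\<close> by (simp add: t_def power_mult_distrib field_simps)
    also have "exp (- L) = \<delta> / N"
      using N \<open>0 < \<delta>\<close> by (simp add: L_def exp_minus)
    finally show ?thesis .
  qed

  define good where "good = {D. J M ?\<rho> \<pi>opt - J M ?\<rho> (weight_policy \<mu> (w\<^sub>D D))
       \<le> 8 * sqrt 2 * B\<^sub>W * C\<^sub>m\<^sub>a\<^sub>x / (gap_Q M * (1 - disc M) ^ 3)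
         * (sqrt (ln (real (card W) * real (card V) / \<delta>)) / sqrt (real n))}"
  \<comment> \<open>On a bad dataset \<open>A (w\<^sub>D D)\<close> exceeds \<open>t\<close>, so
    \<open>f (w\<^sub>D D) v\<close> has mean below \<open>- t\<close>; yet empirical optimality
    makes its sum over the data nonnegative, a deviation of at least \<open>n * t\<close>.\<close>
  have bad: "D \<in> (\<Union>z\<in>W \<times> V. E z)" if D: "D \<in> set_pmf (data_law M \<mu> n)" "D \<notin> good" for D
  proof -
    let ?w = "w\<^sub>D D"
    have sol: "minmax_solution (loss_emp M D) W V ?w"
      using D(1) \<open>\<forall>D\<in>set_pmf (data_law M \<mu> n). minmax_solution (loss_emp M D) W V (w\<^sub>D D)\<close> by blast
    then have w: "?w \<in> W" by (simp add: minmax_solution_def)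
    have len: "length D = n"
      using D(1) by (simp add: data_law_def set_replicate_pmf)
    obtain v where v: "v \<in> V" "loss_emp M D ?w (v_opt M) \<le> loss_emp M D w\<^sub>0 v"
      using minmax_solution_finiteD[OF sol \<open>finite V\<close> \<open>v_opt M \<in> V\<close> w\<^sub>0(1)] .
    then have "0 \<le> sum_list (map (f ?w v) D)"
      using \<open>n \<ge> 1\<close> by (simp add: loss_emp_eq len divide_le_cancel f_def sum_list_subtractf)
    moreover have "t < A ?w"
    proof (rule ccontr)
      assume "\<not> t < A ?w"
      then have le: "A ?w \<le> t" by simp
      \<comment> \<open>Common factor of the derived bound, which has constant 6, and of the claimed
        one, which has constant 8.\<close>
      let ?K = "B\<^sub>W * C\<^sub>m\<^sub>a\<^sub>x / (gap_Q M * g ^ 3) * (sqrt 2 * (sqrt L / sqrt (real n)))"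
      have "J M ?\<rho> \<pi>opt - J M ?\<rho> (weight_policy \<mu> ?w) \<le> C\<^sub>m\<^sub>a\<^sub>x / (gap_Q M * g\<^sup>2) * A ?w"
        unfolding g_def A_def
        using \<open>C\<^sub>m\<^sub>a\<^sub>x > 0\<close> \<open>\<forall>\<pi>. mu_optimal M \<mu> \<pi> \<longrightarrow>
           (\<forall>s. occ_state M \<pi> (state_marg \<mu>) s \<le> C\<^sub>m\<^sub>a\<^sub>x * pmf (state_marg \<mu>) s)\<close>
        by (intro weight_policy_suboptimality[OF M opt \<open>inactive M \<noteq> {}\<close> W[OF w]]) auto
      also have "\<dots> \<le> C\<^sub>m\<^sub>a\<^sub>x / (gap_Q M * g\<^sup>2) * t"
        using le gap \<open>C\<^sub>m\<^sub>a\<^sub>x > 0\<close> by (intro mult_left_mono) auto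
      also have "\<dots> = 6 * ?K"
        by (simp add: t_def c_def real_sqrt_mult real_sqrt_divide power2_eq_square power3_eq_cube mult_ac)
      also have "\<dots> \<le> 8 * ?K"
        using g gap L \<open>C\<^sub>m\<^sub>a\<^sub>x > 0\<close> \<open>B\<^sub>W > 0\<close> by (intro mult_right_mono) auto
      finally show False
        using D(2) by (simp add: good_def g_def L_def N_def mult_ac)
    qed
    moreover have "real n * t \<le> real n * A ?w"
      using \<open>t < A ?w\<close> by (intro mult_left_mono) auto
    moreover have "real n * A ?w \<le> - (real n * measure_pmf.expectation (sample_law M \<mu>) (f ?w v))"
      using mult_left_mono[OF f_mean[OF w, of v], of "real n"] by simp
    ultimately have "D \<in> E (?w, v)"
      by (simp add: E_def)
    then show ?thesis using w v(1) by blast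
  qed
  \<comment> \<open>The inclusion holds only almost surely, since \<open>w\<^sub>D D\<close> is
    constrained only for datasets in the support.\<close>
  have "measure_pmf.prob (data_law M \<mu> n) (- good)
      \<le> measure_pmf.prob (data_law M \<mu> n) (\<Union>z\<in>W \<times> V. E z)"
    using bad by (intro measure_pmf.finite_measure_mono_AE) (auto simp: AE_measure_pmf_iff)
  also have "\<dots> \<le> (\<Sum>z\<in>W \<times> V. measure_pmf.prob (data_law M \<mu> n) (E z))"
    using \<open>finite W\<close> \<open>finite V\<close> by (intro measure_pmf.finite_measure_subadditive_finite) auto
  also have "\<dots> \<le> (\<Sum>z\<in>W \<times> V. \<delta> / N)"
    by (intro sum_mono tail)
  also have "\<dots> = N * (\<delta> / N)"
    by (simp add: N_def card_cartesian_product)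
  also have "\<dots> = \<delta>"
    using N by simp
  finally have "measure_pmf.prob (data_law M \<mu> n) good \<ge> 1 - \<delta>"
    using measure_pmf.prob_compl[of good "data_law M \<mu> n"] by (simp add: Compl_eq_Diff_UNIV)
  then show ?thesis
    by (simp add: good_def)
qed

end
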